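(* Let $k\ge 2$, $\epsilon>0$, and let $B$ be any countable set of non-constant functions from $\{1,\dots,k\}$ to $\mathbb{R}$. Then there exist $C>0$ and a minimal aperiodic subshift $\Omega\subset\{1,\dots,k\}^{\mathbb{Z}}$ whose complexity function $p$ satisfies $p(n)<Cn^{1+\epsilon}$ for all integers $n\ge 1$, such that for any $v\in B$, the Schr\"odinger operator over $\Omega$ with potential $v$ has spectrum of strictly positive Lebesgue measure.
   Context: A subshift $\Omega\subset\{1,\dots,k\}^{\mathbb{Z}}$ is a nonempty compact (product topology of discrete spaces) set invariant under the shift $T$, $(T\omega)_n=\omega_{n+1}$. It is minimal if every $T$-orbit $\{T^n\omega\}_{n\in\mathbb{Z}}$, $\omega\in\Omega$, is dense in $\Omega$, and aperiodic if it contains no $T$-periodic point (for a minimal subshift: if it is not a single periodic orbit). For $n\ge1$, the complexity function $p(n)$ is the number of different words of length $n$ that appear in elements of $\Omega$, i.e. the number of distinct words $\omega_0\omega_1\cdots\omega_{n-1}$, $\omega\in\Omega$. For $v:\{1,\dots,k\}\to\mathbb{R}$ and $\omega\in\Omega$, let $H_\omega$ be the operator on $\ell^2(\mathbb{Z})$ given by $(H_\omega u)_n=u_{n+1}+u_{n-1}+v(\omega_n)u_n$. When $\Omega$ is minimal the spectrum of $H_\omega$ is the same for all $\omega\in\Omega$; this common set is called the spectrum of the Schr\"odinger operator over $\Omega$ with potential $v$. *)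

theory Defs
  imports "HOL-Analysis.Analysis"
begin

section \<open>Subshifts\<close>

text \<open>Bi-infinite sequences over the alphabet \<open>{1..k}\<close> are functions \<open>int \<Rightarrow> nat\<close>;
  the topology below has as its carrier exactly the functions with values in \<open>{1..k}\<close>.\<close>

definition full_shift :: "nat \<Rightarrow> (int \<Rightarrow> nat) topology" where
  "full_shift k = product_topology (\<lambda>_. discrete_topology {1..k}) UNIV"

definition shift :: "(int \<Rightarrow> 'a) \<Rightarrow> int \<Rightarrow> 'a" where
  "shift \<omega> = (\<lambda>n. \<omega> (n + 1))"

definition subshift :: "nat \<Rightarrow> (int \<Rightarrow> nat) set \<Rightarrow> bool" where
  "subshift k \<Omega> \<longleftrightarrow> \<Omega> \<noteq> {} \<and> compactin (full_shift k) \<Omega> \<and> shift ` \<Omega> = \<Omega>"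

text \<open>The two-sided orbit: \<open>\<lambda>m. \<omega> (m + n)\<close> is the \<open>n\<close>-th power of the shift applied to \<open>\<omega>\<close>,
  for every integer \<open>n\<close>.\<close>

definition shift_orbit :: "(int \<Rightarrow> 'a) \<Rightarrow> (int \<Rightarrow> 'a) set" where
  "shift_orbit \<omega> = range (\<lambda>n. \<lambda>m. \<omega> (m + n))"

definition minimal_subshift :: "nat \<Rightarrow> (int \<Rightarrow> nat) set \<Rightarrow> bool" where
  "minimal_subshift k \<Omega> \<longleftrightarrow> subshift k \<Omega> \<and>
     (\<forall>\<omega>\<in>\<Omega>. subtopology (full_shift k) \<Omega> closure_of shift_orbit \<omega> = \<Omega>)"

definition aperiodic :: "(int \<Rightarrow> 'a) set \<Rightarrow> bool" where
  "aperiodic \<Omega> \<longleftrightarrow> \<not> (\<exists>\<omega>\<in>\<Omega>. \<exists>n>0. (shift ^^ n) \<omega> = \<omega>)"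

definition complexity :: "(int \<Rightarrow> 'a) set \<Rightarrow> nat \<Rightarrow> nat" where
  "complexity \<Omega> n = card ((\<lambda>\<omega>. map (\<lambda>i. \<omega> (int i)) [0..<n]) ` \<Omega>)"

section \<open>Schroedinger operators on the two-sided sequence space\<close>

definition ell2 :: "(int \<Rightarrow> complex) set" where
  "ell2 = {u. (\<lambda>n. (cmod (u n))\<^sup>2) summable_on UNIV}"

definition ell2_norm :: "(int \<Rightarrow> complex) \<Rightarrow> real" where
  "ell2_norm u = sqrt (\<Sum>\<^sub>\<infinity>n. (cmod (u n))\<^sup>2)"

text \<open>Operators on \<^const>\<open>ell2\<close> are represented by functions on all sequences; only their
  restriction to \<^const>\<open>ell2\<close> matters.\<close>

definition bounded_ell2_operator :: "((int \<Rightarrow> complex) \<Rightarrow> (int \<Rightarrow> complex)) \<Rightarrow> bool" where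
  "bounded_ell2_operator A \<longleftrightarrow>
     (\<forall>u\<in>ell2. A u \<in> ell2) \<and>
     (\<forall>u\<in>ell2. \<forall>w\<in>ell2. \<forall>a b. A (\<lambda>n. a * u n + b * w n) = (\<lambda>n. a * A u n + b * A w n)) \<and>
     (\<exists>K. \<forall>u\<in>ell2. ell2_norm (A u) \<le> K * ell2_norm u)"

definition ell2_spectrum :: "((int \<Rightarrow> complex) \<Rightarrow> (int \<Rightarrow> complex)) \<Rightarrow> complex set" where
  "ell2_spectrum A = {z. \<not> (\<exists>R. bounded_ell2_operator R \<and>
     (\<forall>u\<in>ell2. R (\<lambda>n. A u n - z * u n) = u \<and> (\<lambda>n. A (R u) n - z * R u n) = u))}"

definition schroedinger :: "('a \<Rightarrow> real) \<Rightarrow> (int \<Rightarrow> 'a) \<Rightarrow> (int \<Rightarrow> complex) \<Rightarrow> int \<Rightarrow> complex" where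
  "schroedinger v \<omega> u = (\<lambda>n. u (n + 1) + u (n - 1) + complex_of_real (v (\<omega> n)) * u n)"

text \<open>The common spectrum of all the operators over \<open>\<Omega>\<close>; for nonempty \<open>\<Omega>\<close> there is at most one
  such \<open>S\<close>, and for minimal \<open>\<Omega>\<close> it exists.\<close>

definition has_spectrum_over :: "(int \<Rightarrow> 'a) set \<Rightarrow> ('a \<Rightarrow> real) \<Rightarrow> complex set \<Rightarrow> bool" where
  "has_spectrum_over \<Omega> v S \<longleftrightarrow> (\<forall>\<omega>\<in>\<Omega>. ell2_spectrum (schroedinger v \<omega>) = S)"

text \<open>These spectra are real, since the operators are self-adjoint, so their Lebesgue measure is
  that of the preimage under the embedding of the real line. A positive \<^const>\<open>emeasure\<close>
  includes measurability, because \<^const>\<open>emeasure\<close> vanishes on nonmeasurable sets.\<close>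

definition real_lebesgue_measure :: "complex set \<Rightarrow> ennreal" where
  "real_lebesgue_measure S = emeasure lebesgue (complex_of_real -` S)"

end

theory Submission
  imports Defs "HOL-Computational_Algebra.Fundamental_Theorem_Algebra" "HOL-Library.Sublist"
begin

text \<open>Lebesgue measure only asks for many energies in the spectrum, so different energies may be
  served by different words. The construction has levels; each level is a finite list of words.
  An energy is good at a level if the one-period transfer matrix of at least one of its words is
  elliptic, that is, has trace of modulus less than 2. From a level with words \<open>w\<close> and
  concatenation \<open>s\<close>, the next level consists of all words \<open>w^(N + j) s\<close> with \<open>j < J\<close>.

  Good energies survive this step. If \<open>tr A = 2 cos \<theta>\<close> for the matrix \<open>A\<close> of \<open>w\<close>, then the trace
  belonging to \<open>w^m s\<close> is a sinusoid in \<open>m\<close> of frequency \<open>\<theta>\<close>. When \<open>\<theta> / pi\<close> is irrational, which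
  excludes only countably many energies, one of \<open>J\<close> consecutive exponents makes this trace
  small, and the required \<open>J\<close> depends on the energy but not on \<open>N\<close>
  (\<open>band_power_window\<close>). Hence the measure lost in one step is arbitrarily small for large \<open>J\<close>,
  uniformly in \<open>N\<close>, and for finitely many potentials at once (\<open>level_bands_loss_small\<close>). The
  \<open>t\<close>-th potential of the countable family is looked after from level \<open>t\<close> on: the good energies
  are then a nonempty open set because every discriminant has a real root
  (\<open>disc_has_real_root\<close>), and the later losses are at most half of its measure. An energy that is
  good at all levels from \<open>t\<close> on lies in the spectrum, because every sequence of the subshift
  contains \<open>w^N\<close> and a Bloch wave cut off to this stretch is an approximate eigenvector
  with an error of order \<open>1 / sqrt N\<close> (\<open>approximate_eigenvector_in_power\<close>).

  Since \<open>N\<close> is chosen after \<open>J\<close>, the complexity stays low. With \<open>r\<close> words at a level, a word of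
  length \<open>l \<le> N\<close> of the subshift is a window of some sequence \<open>... w w s w' w' ...\<close> starting
  near \<open>s\<close>, which leaves at most \<open>r\<^sup>2 (l + 2 |s|)\<close> possibilities (\<open>complexity_Omega_le\<close>). Of the
  quantities in the bound for the next level, the number of words does not involve \<open>N\<close> and the
  length of the concatenation is at most a constant times \<open>N\<close>, so the factor \<open>l powr \<epsilon>\<close> absorbs
  them when \<open>N\<close> is large (\<open>counting_bound_next_level\<close>).

  Every word of a level is a factor of every word of the next level, which gives minimality.
  The presence of two consecutive exponents makes the periods of a periodic sequence
  descend to the words \<open>1\<close> and \<open>2\<close> of level 0, so that such a sequence would be constant; this
  gives aperiodicity. Finally, belonging to the spectrum is a condition on finite patterns
  (\<open>not_in_ell2_spectrum_iff\<close>), so it is the same for all sequences of the subshift.\<close>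

section \<open>Square-summable sequences\<close>

text \<open>Norm bounds and membership are tested on finite sums. This makes them stable under
  pointwise limits, which is the only form of completeness that is needed below.\<close>

lemma ell2_boundI:
  assumes "K \<ge> 0" and "\<And>A. finite A \<Longrightarrow> (\<Sum>n\<in>A. (cmod (u n))\<^sup>2) \<le> K\<^sup>2"
  shows "u \<in> ell2" and "ell2_norm u \<le> K"
proof -
  have s: "(\<lambda>n. (cmod (u n))\<^sup>2) summable_on UNIV"
    by (rule nonneg_bdd_above_summable_on) (auto intro!: bdd_aboveI2[where M = "K\<^sup>2"] assms(2))
  then show "u \<in> ell2"
    by (simp add: ell2_def)
  have "(\<Sum>\<^sub>\<infinity>n. (cmod (u n))\<^sup>2) \<le> K\<^sup>2"
    by (rule infsum_le_finite_sums[OF s]) (auto intro: assms(2))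
  then show "ell2_norm u \<le> K"
    using assms(1) by (simp add: ell2_norm_def real_le_lsqrt)
qed

lemma ell2_norm_nonneg [simp]: "ell2_norm u \<ge> 0"
  by (simp add: ell2_norm_def infsum_nonneg)

lemma ell2_norm_sq: "(ell2_norm u)\<^sup>2 = (\<Sum>\<^sub>\<infinity>n. (cmod (u n))\<^sup>2)"
  by (simp add: ell2_norm_def infsum_nonneg)

lemma ell2_finite_sum_le:
  assumes "u \<in> ell2" "finite A"
  shows "(\<Sum>n\<in>A. (cmod (u n))\<^sup>2) \<le> (ell2_norm u)\<^sup>2"
  unfolding ell2_norm_sq using assms by (intro finite_sum_le_infsum) (auto simp: ell2_def)

lemma ell2_coord_le:
  assumes "u \<in> ell2"
  shows "cmod (u n) \<le> ell2_norm u"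
  using ell2_finite_sum_le[OF assms, of "{n}"] by (simp add: power2_le_iff_abs_le)

lemma ell2_norm_le_zeroD: "u \<in> ell2 \<Longrightarrow> ell2_norm u \<le> 0 \<Longrightarrow> u n = 0"
  using order_trans[OF ell2_coord_le] norm_le_zero_iff by blast

lemma ell2_finite_support:
  assumes "finite {n. u n \<noteq> 0}"
  shows "u \<in> ell2"
proof -
  have "(\<lambda>n. (cmod (u n))\<^sup>2) summable_on {n. u n \<noteq> 0}"
    using assms by simp
  then show ?thesis
    unfolding ell2_def mem_Collect_eq
    by (rule summable_on_cong_neutral[THEN iffD1, rotated -1]) auto
qed

lemma ell2_norm_sq_finite_support:
  assumes "finite A" and "\<And>n. n \<notin> A \<Longrightarrow> u n = 0"
  shows "(ell2_norm u)\<^sup>2 = (\<Sum>n\<in>A. (cmod (u n))\<^sup>2)"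
proof -
  have "(\<Sum>\<^sub>\<infinity>n. (cmod (u n))\<^sup>2) = (\<Sum>\<^sub>\<infinity>n\<in>A. (cmod (u n))\<^sup>2)"
    by (rule infsum_cong_neutral) (use assms(2) in auto)
  then show ?thesis
    using assms(1) by (simp add: ell2_norm_sq)
qed

lemma ell2_add:
  assumes "u \<in> ell2" "w \<in> ell2"
  shows "(\<lambda>n. u n + w n) \<in> ell2" and "ell2_norm (\<lambda>n. u n + w n) \<le> ell2_norm u + ell2_norm w"
proof -
  have *: "(\<Sum>n\<in>A. (cmod (u n + w n))\<^sup>2) \<le> (ell2_norm u + ell2_norm w)\<^sup>2" if "finite A" for A
  proof -
    have "L2_set (\<lambda>n. cmod (u n + w n)) A \<le> L2_set (\<lambda>n. cmod (u n) + cmod (w n)) A"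
      by (intro L2_set_mono norm_triangle_ineq) auto
    also have "\<dots> \<le> L2_set (\<lambda>n. cmod (u n)) A + L2_set (\<lambda>n. cmod (w n)) A"
      by (rule L2_set_triangle_ineq)
    also have "\<dots> \<le> ell2_norm u + ell2_norm w"
      unfolding L2_set_def
      by (intro add_mono real_le_lsqrt ell2_finite_sum_le assms that) auto
    finally have "(L2_set (\<lambda>n. cmod (u n + w n)) A)\<^sup>2 \<le> (ell2_norm u + ell2_norm w)\<^sup>2"
      by (intro power_mono) auto
    then show ?thesis
      by (simp add: L2_set_def sum_nonneg)
  qed
  show "(\<lambda>n. u n + w n) \<in> ell2"
    by (rule ell2_boundI(1)[of "ell2_norm u + ell2_norm w"]) (use * in auto)
  show "ell2_norm (\<lambda>n. u n + w n) \<le> ell2_norm u + ell2_norm w"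
    by (rule ell2_boundI(2)) (use * in auto)
qed

lemma ell2_mult_bounded:
  assumes "u \<in> ell2" and "\<And>n. cmod (q n) \<le> M"
  shows "(\<lambda>n. q n * u n) \<in> ell2" and "ell2_norm (\<lambda>n. q n * u n) \<le> M * ell2_norm u"
proof -
  have M: "M \<ge> 0"
    using assms(2)[of 0] norm_ge_zero order_trans by blast
  have *: "(\<Sum>n\<in>A. (cmod (q n * u n))\<^sup>2) \<le> (M * ell2_norm u)\<^sup>2" if "finite A" for A
  proof -
    have "(\<Sum>n\<in>A. (cmod (q n * u n))\<^sup>2) \<le> (\<Sum>n\<in>A. M\<^sup>2 * (cmod (u n))\<^sup>2)"
      by (intro sum_mono) (auto simp: norm_mult power_mult_distrib intro!: mult_right_mono power_mono assms(2))
    also have "\<dots> \<le> M\<^sup>2 * (ell2_norm u)\<^sup>2"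
      unfolding sum_distrib_left[symmetric]
      by (intro mult_left_mono ell2_finite_sum_le assms that) auto
    finally show ?thesis
      by (simp add: power_mult_distrib)
  qed
  show "(\<lambda>n. q n * u n) \<in> ell2"
    by (rule ell2_boundI(1)[of "M * ell2_norm u"]) (use * M in auto)
  show "ell2_norm (\<lambda>n. q n * u n) \<le> M * ell2_norm u"
    by (rule ell2_boundI(2)) (use * M in auto)
qed

lemma ell2_scale:
  assumes "u \<in> ell2"
  shows "(\<lambda>n. c * u n) \<in> ell2" and "ell2_norm (\<lambda>n. c * u n) = cmod c * ell2_norm u"
proof -
  show "(\<lambda>n. c * u n) \<in> ell2"
    using ell2_mult_bounded(1)[OF assms, of "\<lambda>_. c" "cmod c"] by simp
  have "(\<Sum>\<^sub>\<infinity>n. (cmod (c * u n))\<^sup>2) = (cmod c)\<^sup>2 * (\<Sum>\<^sub>\<infinity>n. (cmod (u n))\<^sup>2)"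
    by (simp add: norm_mult power_mult_distrib infsum_cmult_right')
  then show "ell2_norm (\<lambda>n. c * u n) = cmod c * ell2_norm u"
    by (simp add: ell2_norm_def real_sqrt_mult)
qed

lemma ell2_diff:
  assumes "u \<in> ell2" "w \<in> ell2"
  shows "(\<lambda>n. u n - w n) \<in> ell2" and "ell2_norm (\<lambda>n. u n - w n) \<le> ell2_norm u + ell2_norm w"
  using ell2_add[OF assms(1) ell2_scale(1)[OF assms(2), of "-1"]] ell2_scale(2)[OF assms(2), of "-1"]
  by auto

lemma bij_int_shift: "bij_betw (\<lambda>n::int. n + a) UNIV UNIV"
  by (rule bij_betwI[of _ _ _ "\<lambda>n. n - a"]) auto

lemma ell2_translate:
  shows "(\<lambda>n. u (n + a)) \<in> ell2 \<longleftrightarrow> u \<in> ell2" and "ell2_norm (\<lambda>n. u (n + a)) = ell2_norm u"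
  using summable_on_reindex_bij_betw[OF bij_int_shift, of "\<lambda>n. (cmod (u n))\<^sup>2" a]
    infsum_reindex_bij_betw[OF bij_int_shift, of "\<lambda>n. (cmod (u n))\<^sup>2" a]
  by (simp_all add: ell2_def ell2_norm_def)

lemma ell2_approx_finite_support:
  assumes "u \<in> ell2" "e > 0"
  obtains F where "finite F" and "ell2_norm (\<lambda>n. u n - (if n \<in> F then u n else 0)) \<le> e"
proof -
  let ?f = "\<lambda>n. (cmod (u n))\<^sup>2"
  have s: "?f summable_on UNIV"
    using assms(1) by (simp add: ell2_def)
  have "\<exists>F. finite F \<and> infsum ?f UNIV - e\<^sup>2 < sum ?f F"
  proof (rule ccontr)
    assume "\<not> ?thesis"
    then have "infsum ?f UNIV \<le> infsum ?f UNIV - e\<^sup>2"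
      by (intro infsum_le_finite_sums[OF s]) (auto simp: not_less)
    then show False
      using assms(2) by simp
  qed
  then obtain F where F: "finite F" "infsum ?f UNIV - e\<^sup>2 < sum ?f F"
    by blast
  let ?r = "\<lambda>n. u n - (if n \<in> F then u n else 0)"
  have "(\<Sum>n\<in>A. (cmod (?r n))\<^sup>2) \<le> e\<^sup>2" if "finite A" for A
  proof -
    have "(\<Sum>n\<in>A. (cmod (?r n))\<^sup>2) = sum ?f (A - F)"
      using that by (intro sum.mono_neutral_cong_right) auto
    moreover have "sum ?f (A - F) + sum ?f F = sum ?f ((A - F) \<union> F)"
      using that F(1) by (intro sum.union_disjoint[symmetric]) auto
    moreover have "sum ?f ((A - F) \<union> F) \<le> infsum ?f UNIV"
      using that F(1) by (intro finite_sum_le_infsum s) auto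
    ultimately show ?thesis
      using F(2) by linarith
  qed
  then have "ell2_norm ?r \<le> e"
    by (intro ell2_boundI(2)) (use assms(2) in auto)
  with F(1) show ?thesis
    by (rule that)
qed

definition ell2_inner :: "(int \<Rightarrow> complex) \<Rightarrow> (int \<Rightarrow> complex) \<Rightarrow> complex" where
  "ell2_inner u w = (\<Sum>\<^sub>\<infinity>n. u n * cnj (w n))"

lemma ell2_inner_summable:
  assumes "u \<in> ell2" "w \<in> ell2"
  shows "(\<lambda>n. u n * cnj (w n)) summable_on UNIV"
proof -
  have "(\<lambda>n. (cmod (u n))\<^sup>2 + (cmod (w n))\<^sup>2) summable_on UNIV"
    using assms by (intro summable_on_add) (auto simp: ell2_def)
  then have "(\<lambda>n. norm (u n * cnj (w n))) summable_on UNIV"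
  proof (rule summable_on_comparison_test)
    fix n
    have "2 * (cmod (u n) * cmod (w n)) \<le> (cmod (u n))\<^sup>2 + (cmod (w n))\<^sup>2"
      using sum_squares_bound[of "cmod (u n)" "cmod (w n)"] by simp
    moreover have "0 \<le> cmod (u n) * cmod (w n)"
      by simp
    ultimately show "norm (u n * cnj (w n)) \<le> (cmod (u n))\<^sup>2 + (cmod (w n))\<^sup>2"
      by (simp only: norm_mult complex_mod_cnj)
  qed auto
  then show ?thesis
    by (rule abs_summable_summable)
qed

lemma ell2_norm_sq_diff_scaled:
  fixes a :: real
  assumes "u \<in> ell2" "w \<in> ell2"
  shows "(ell2_norm (\<lambda>n. u n - of_real a * w n))\<^sup>2
           = (ell2_norm u)\<^sup>2 - 2 * a * Re (ell2_inner u w) + a\<^sup>2 * (ell2_norm w)\<^sup>2"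
proof -
  have *: "(cmod (u n - of_real a * w n))\<^sup>2
             = (cmod (u n))\<^sup>2 + (- 2 * a) * Re (u n * cnj (w n)) + a\<^sup>2 * (cmod (w n))\<^sup>2" for n
    unfolding cmod_power2 by (simp add: power2_eq_square algebra_simps)
  have s: "(\<lambda>n. (cmod (u n))\<^sup>2) summable_on UNIV" "(\<lambda>n. (cmod (w n))\<^sup>2) summable_on UNIV"
    using assms by (auto simp: ell2_def)
  have r: "((\<lambda>n. Re (u n * cnj (w n))) has_sum Re (ell2_inner u w)) UNIV"
    unfolding ell2_inner_def
    by (intro has_sum_Re has_sum_infsum ell2_inner_summable assms)
  have "((\<lambda>n. (cmod (u n))\<^sup>2 + (- 2 * a) * Re (u n * cnj (w n)) + a\<^sup>2 * (cmod (w n))\<^sup>2) has_sum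
     ((ell2_norm u)\<^sup>2 + (- 2 * a) * Re (ell2_inner u w) + a\<^sup>2 * (ell2_norm w)\<^sup>2)) UNIV"
    unfolding ell2_norm_sq
    by (intro has_sum_add has_sum_cmult_right r has_sum_infsum s)
  then show ?thesis
    unfolding ell2_norm_sq[of "\<lambda>n. u n - of_real a * w n"] * by (simp add: infsumI)
qed

lemma ell2_inner_self: "u \<in> ell2 \<Longrightarrow> Re (ell2_inner u u) = (ell2_norm u)\<^sup>2"
proof -
  assume u: "u \<in> ell2"
  have "((\<lambda>n. Re (u n * cnj (u n))) has_sum Re (ell2_inner u u)) UNIV"
    unfolding ell2_inner_def by (intro has_sum_Re has_sum_infsum ell2_inner_summable u)
  moreover have "Re (u n * cnj (u n)) = (cmod (u n))\<^sup>2" for n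
    unfolding cmod_power2 by (simp add: power2_eq_square)
  ultimately show ?thesis
    unfolding ell2_norm_sq by (simp add: infsumI)
qed


section \<open>The spectrum of a Schroedinger operator\<close>

definition shifted_op :: "('a \<Rightarrow> real) \<Rightarrow> (int \<Rightarrow> 'a) \<Rightarrow> complex \<Rightarrow> (int \<Rightarrow> complex) \<Rightarrow> int \<Rightarrow> complex"
  where "shifted_op v \<omega> z u = (\<lambda>n. schroedinger v \<omega> u n - z * u n)"

text \<open>Only finitely supported sequences are tested, so this is a condition on the finite patterns
  of \<open>\<omega>\<close>, uniform in their position.\<close>

definition bounded_below :: "('a \<Rightarrow> real) \<Rightarrow> (int \<Rightarrow> 'a) \<Rightarrow> complex \<Rightarrow> real \<Rightarrow> bool" where
  "bounded_below v \<omega> z c \<longleftrightarrow>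
     (\<forall>u. finite {n. u n \<noteq> 0} \<longrightarrow> c * ell2_norm u \<le> ell2_norm (shifted_op v \<omega> z u))"

text \<open>A definition, and not the bare inequality, so that \<open>v\<close> and \<open>\<omega>\<close> can be read off from it by
  first-order unification.\<close>

definition potential_bound :: "('a \<Rightarrow> real) \<Rightarrow> (int \<Rightarrow> 'a) \<Rightarrow> real \<Rightarrow> bool" where
  "potential_bound v \<omega> V \<longleftrightarrow> (\<forall>n. \<bar>v (\<omega> n)\<bar> \<le> V)"

lemma potential_boundD: "potential_bound v \<omega> V \<Longrightarrow> \<bar>v (\<omega> n)\<bar> \<le> V"
  by (simp add: potential_bound_def)

lemma shifted_op_altdef:
  "shifted_op v \<omega> z u = (\<lambda>n. u (n + 1) + u (n - 1) + (of_real (v (\<omega> n)) - z) * u n)"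
  by (rule ext) (simp add: shifted_op_def schroedinger_def algebra_simps)

lemma shifted_op_lincomb:
  "shifted_op v \<omega> z (\<lambda>n. a * u n + b * w n)
     = (\<lambda>n. a * shifted_op v \<omega> z u n + b * shifted_op v \<omega> z w n)"
  by (rule ext) (simp add: shifted_op_altdef algebra_simps)

lemma shifted_op_diff:
  "shifted_op v \<omega> z (\<lambda>n. u n - w n) = (\<lambda>n. shifted_op v \<omega> z u n - shifted_op v \<omega> z w n)"
  by (rule ext) (simp add: shifted_op_altdef algebra_simps)

lemma shifted_op_ell2:
  assumes "u \<in> ell2" and V: "potential_bound v \<omega> V"
  shows "shifted_op v \<omega> z u \<in> ell2"
    and "ell2_norm (shifted_op v \<omega> z u) \<le> (2 + V + cmod z) * ell2_norm u"
proof -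
  have 1: "(\<lambda>n. u (n + 1)) \<in> ell2" "ell2_norm (\<lambda>n. u (n + 1)) = ell2_norm u"
    using ell2_translate[of u 1] assms(1) by auto
  have 2: "(\<lambda>n. u (n - 1)) \<in> ell2" "ell2_norm (\<lambda>n. u (n - 1)) = ell2_norm u"
    using ell2_translate[of u "-1"] assms(1) by auto
  have q: "cmod (of_real (v (\<omega> n)) - z) \<le> V + cmod z" for n
    using norm_triangle_ineq4[of "of_real (v (\<omega> n))" z] potential_boundD[OF V, of n] by simp
  note 3 = ell2_mult_bounded[where q = "\<lambda>n. of_real (v (\<omega> n)) - z", OF assms(1) q]
  note 4 = ell2_add[OF ell2_add(1)[OF 1(1) 2(1)] 3(1)]
  show "shifted_op v \<omega> z u \<in> ell2"
    using 4(1) by (simp add: shifted_op_altdef)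
  show "ell2_norm (shifted_op v \<omega> z u) \<le> (2 + V + cmod z) * ell2_norm u"
    using 4(2) 3(2) ell2_add(2)[OF 1(1) 2(1)] 1(2) 2(2)
    by (simp add: shifted_op_altdef algebra_simps)
qed

lemma shifted_op_adjoint:
  assumes u: "u \<in> ell2" and w: "w \<in> ell2" and V: "potential_bound v \<omega> V"
  shows "ell2_inner u (shifted_op v \<omega> (cnj z) w) = ell2_inner (shifted_op v \<omega> z u) w"
proof -
  let ?q = "\<lambda>n. of_real (v (\<omega> n)) - z"
  have q: "cmod (?q n) \<le> V + cmod z" for n
    using norm_triangle_ineq4[of "of_real (v (\<omega> n))" z] potential_boundD[OF V, of n] by simp
  have s: "(\<lambda>n. u (n + 1)) \<in> ell2" "(\<lambda>n. u (n - 1)) \<in> ell2"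
    "(\<lambda>n. w (n + 1)) \<in> ell2" "(\<lambda>n. w (n - 1)) \<in> ell2"
    using ell2_translate(1)[of u 1] ell2_translate(1)[of u "-1"]
      ell2_translate(1)[of w 1] ell2_translate(1)[of w "-1"] u w by auto
  have 3: "(\<lambda>n. ?q n * u n * cnj (w n)) summable_on UNIV"
    using ell2_inner_summable[OF ell2_mult_bounded(1)[OF u q] w] .
  have 1: "(\<Sum>\<^sub>\<infinity>n. u (n + 1) * cnj (w n)) = (\<Sum>\<^sub>\<infinity>n. u n * cnj (w (n - 1)))"
    using infsum_reindex_bij_betw[OF bij_int_shift, of "\<lambda>n. u n * cnj (w (n - 1))" 1] by simp
  have 2: "(\<Sum>\<^sub>\<infinity>n. u (n - 1) * cnj (w n)) = (\<Sum>\<^sub>\<infinity>n. u n * cnj (w (n + 1)))"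
    using infsum_reindex_bij_betw[OF bij_int_shift, of "\<lambda>n. u n * cnj (w (n + 1))" "-1"] by simp
  have "ell2_inner (shifted_op v \<omega> z u) w
      = (\<Sum>\<^sub>\<infinity>n. u (n + 1) * cnj (w n) + u (n - 1) * cnj (w n) + ?q n * u n * cnj (w n))"
    by (simp add: ell2_inner_def shifted_op_altdef algebra_simps)
  also have "\<dots> = (\<Sum>\<^sub>\<infinity>n. u (n + 1) * cnj (w n)) + (\<Sum>\<^sub>\<infinity>n. u (n - 1) * cnj (w n))
       + (\<Sum>\<^sub>\<infinity>n. ?q n * u n * cnj (w n))"
    by (subst infsum_add infsum_add, intro summable_on_add ell2_inner_summable s w, rule 3,
        subst infsum_add, intro ell2_inner_summable s w, intro ell2_inner_summable s w, rule refl)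
  also have "\<dots> = (\<Sum>\<^sub>\<infinity>n. u n * cnj (w (n - 1))) + (\<Sum>\<^sub>\<infinity>n. u n * cnj (w (n + 1)))
       + (\<Sum>\<^sub>\<infinity>n. ?q n * u n * cnj (w n))"
    by (simp only: 1 2)
  also have "\<dots> = (\<Sum>\<^sub>\<infinity>n. u n * cnj (w (n - 1)) + u n * cnj (w (n + 1)) + ?q n * u n * cnj (w n))"
    by (subst infsum_add infsum_add, intro summable_on_add ell2_inner_summable s u, rule 3,
        subst infsum_add, intro ell2_inner_summable s u, intro ell2_inner_summable s u, rule refl)
  also have "\<dots> = ell2_inner u (shifted_op v \<omega> (cnj z) w)"
    by (simp add: ell2_inner_def shifted_op_altdef algebra_simps)
  finally show ?thesis
    by simp
qed

lemma shifted_op_cnj: "shifted_op v \<omega> (cnj z) u = (\<lambda>n. cnj (shifted_op v \<omega> z (\<lambda>n. cnj (u n)) n))"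
  by (rule ext) (simp add: shifted_op_altdef)

lemma bounded_below_cnj:
  assumes "bounded_below v \<omega> z c"
  shows "bounded_below v \<omega> (cnj z) c"
  unfolding bounded_below_def
proof (intro allI impI)
  fix u :: "int \<Rightarrow> complex"
  assume "finite {n. u n \<noteq> 0}"
  then have "c * ell2_norm (\<lambda>n. cnj (u n)) \<le> ell2_norm (shifted_op v \<omega> z (\<lambda>n. cnj (u n)))"
    using assms by (simp add: bounded_below_def)
  then show "c * ell2_norm u \<le> ell2_norm (shifted_op v \<omega> (cnj z) u)"
    unfolding shifted_op_cnj by (simp add: ell2_norm_def)
qed

lemma bounded_below_ell2:
  assumes below: "bounded_below v \<omega> z c" and "c \<ge> 0" and u: "u \<in> ell2"
    and V: "potential_bound v \<omega> V"
  shows "c * ell2_norm u \<le> ell2_norm (shifted_op v \<omega> z u)"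
proof (rule field_le_epsilon)
  fix e :: real
  assume "e > 0"
  let ?T = "shifted_op v \<omega> z"
  define K where "K = c + (2 + V + cmod z)"
  have V0: "V \<ge> 0"
    using potential_boundD[OF V, of 0] by linarith
  then have K: "K > 0"
    using assms(2) norm_ge_zero[of z] unfolding K_def by linarith
  then obtain F where F: "finite F" "ell2_norm (\<lambda>n. u n - (if n \<in> F then u n else 0)) \<le> e / K"
    using ell2_approx_finite_support[OF u, of "e / K"] \<open>e > 0\<close> by auto
  define a where "a = (\<lambda>n. if n \<in> F then u n else 0)"
  define r where "r = (\<lambda>n. u n - a n)"
  have fin: "finite {n. a n \<noteq> 0}"
    by (rule finite_subset[OF _ F(1)]) (auto simp: a_def)
  then have a: "a \<in> ell2"
    by (rule ell2_finite_support)
  then have r: "r \<in> ell2"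
    unfolding r_def by (rule ell2_diff(1)[OF u])
  have re: "ell2_norm r \<le> e / K"
    using F(2) by (simp add: r_def a_def)
  have "c * ell2_norm u \<le> c * (ell2_norm a + ell2_norm r)"
    using ell2_add(2)[OF a r] assms(2) by (intro mult_left_mono) (auto simp: r_def)
  also have "c * ell2_norm a \<le> ell2_norm (?T a)"
    using below fin by (simp add: bounded_below_def)
  then have "c * (ell2_norm a + ell2_norm r) \<le> ell2_norm (?T a) + c * ell2_norm r"
    by (simp add: algebra_simps)
  also have "?T a = (\<lambda>n. ?T u n - ?T r n)"
    unfolding shifted_op_diff[symmetric] by (simp add: r_def)
  then have "ell2_norm (?T a) \<le> ell2_norm (?T u) + ell2_norm (?T r)"
    using ell2_diff(2)[OF shifted_op_ell2(1)[OF u V] shifted_op_ell2(1)[OF r V]] by simp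
  also have "ell2_norm (?T r) \<le> (2 + V + cmod z) * ell2_norm r"
    by (rule shifted_op_ell2(2)[OF r V])
  finally have "c * ell2_norm u \<le> ell2_norm (?T u) + K * ell2_norm r"
    by (simp add: K_def algebra_simps)
  also have "K * ell2_norm r \<le> e"
    using re K by (simp add: field_simps)
  finally show "c * ell2_norm u \<le> ell2_norm (?T u) + e"
    by simp
qed

text \<open>With \<open>T = H - z\<close> and \<open>A = H - cnj z\<close>, its adjoint, the equation \<open>A T u = A f\<close> is solved by
  iterating \<open>u \<mapsto> u - \<alpha> A (T u) + \<alpha> A f\<close>. For \<open>\<alpha> = 1 / K\<^sup>2\<close> with \<open>K\<close> a bound for both norms this
  is a contraction, by expanding the square of the norm and using \<open>c |u| \<le> |T u|\<close>. As \<open>A\<close> is also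
  bounded below, hence injective, the limit solves \<open>T u = f\<close>.\<close>

lemma shifted_op_surj:
  assumes below: "bounded_below v \<omega> z c" and c: "c > 0" and f: "f \<in> ell2"
    and V: "potential_bound v \<omega> V"
  shows "\<exists>u\<in>ell2. shifted_op v \<omega> z u = f"
proof -
  let ?T = "shifted_op v \<omega> z" and ?A = "shifted_op v \<omega> (cnj z)"
  define K where "K = 2 + V + cmod z + c"
  have V0: "V \<ge> 0"
    using potential_boundD[OF V, of 0] by linarith
  have K: "K > 0" "c \<le> K"
    using c V0 norm_ge_zero[of z] unfolding K_def by linarith+
  have T: "?T u \<in> ell2" "ell2_norm (?T u) \<le> K * ell2_norm u" if "u \<in> ell2" for u
  proof -
    show "?T u \<in> ell2"
      by (rule shifted_op_ell2(1)[OF that V])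
    have "ell2_norm (?T u) \<le> (2 + V + cmod z) * ell2_norm u"
      by (rule shifted_op_ell2(2)[OF that V])
    also have "\<dots> \<le> K * ell2_norm u"
      using c by (intro mult_right_mono) (auto simp: K_def)
    finally show "ell2_norm (?T u) \<le> K * ell2_norm u" .
  qed
  have A: "?A u \<in> ell2" "ell2_norm (?A u) \<le> K * ell2_norm u" if "u \<in> ell2" for u
  proof -
    show "?A u \<in> ell2"
      by (rule shifted_op_ell2(1)[OF that V])
    have "ell2_norm (?A u) \<le> (2 + V + cmod (cnj z)) * ell2_norm u"
      by (rule shifted_op_ell2(2)[OF that V])
    also have "\<dots> \<le> K * ell2_norm u"
      using c by (intro mult_right_mono) (auto simp: K_def)
    finally show "ell2_norm (?A u) \<le> K * ell2_norm u" .
  qed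
  have lowT: "c * ell2_norm u \<le> ell2_norm (?T u)" if "u \<in> ell2" for u
    by (rule bounded_below_ell2[OF below _ that V]) (use c in auto)
  have lowA: "c * ell2_norm u \<le> ell2_norm (?A u)" if "u \<in> ell2" for u
    by (rule bounded_below_ell2[OF bounded_below_cnj[OF below] _ that V]) (use c in auto)
  define \<alpha> where "\<alpha> = 1 / K\<^sup>2"
  define \<kappa> where "\<kappa> = sqrt (1 - c\<^sup>2 / K\<^sup>2)"
  have ck: "c\<^sup>2 \<le> K\<^sup>2"
    using c K by (intro power_mono) auto
  then have "0 \<le> 1 - c\<^sup>2 / K\<^sup>2" "1 - c\<^sup>2 / K\<^sup>2 < 1"
    using c K(1) by (simp_all add: divide_le_eq_1)
  then have \<kappa>: "0 \<le> \<kappa>" "\<kappa> < 1" "\<kappa>\<^sup>2 = 1 - c\<^sup>2 / K\<^sup>2"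
    unfolding \<kappa>_def by simp_all
  define Q where "Q = (\<lambda>u n. u n - of_real \<alpha> * ?A (?T u) n)"
  have QE: "Q u \<in> ell2" if "u \<in> ell2" for u
    unfolding Q_def by (intro ell2_diff(1) ell2_scale(1) A T that)
  have contr: "ell2_norm (Q u) \<le> \<kappa> * ell2_norm u" if u: "u \<in> ell2" for u
  proof -
    have Tu: "?T u \<in> ell2" and ATu: "?A (?T u) \<in> ell2"
      using T A u by auto
    have "ell2_inner u (?A (?T u)) = ell2_inner (?T u) (?T u)"
      by (rule shifted_op_adjoint[OF u Tu V])
    then have re: "Re (ell2_inner u (?A (?T u))) = (ell2_norm (?T u))\<^sup>2"
      by (simp add: ell2_inner_self[OF Tu])
    have "(ell2_norm (?A (?T u)))\<^sup>2 \<le> (K * ell2_norm (?T u))\<^sup>2"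
      by (intro power_mono A Tu) auto
    then have "\<alpha>\<^sup>2 * (ell2_norm (?A (?T u)))\<^sup>2 \<le> \<alpha>\<^sup>2 * (K * ell2_norm (?T u))\<^sup>2"
      by (intro mult_left_mono) auto
    also have "\<dots> = \<alpha> * (ell2_norm (?T u))\<^sup>2"
      using K by (simp add: \<alpha>_def power2_eq_square field_simps)
    finally have "(ell2_norm (Q u))\<^sup>2 \<le> (ell2_norm u)\<^sup>2 - \<alpha> * (ell2_norm (?T u))\<^sup>2"
      unfolding Q_def ell2_norm_sq_diff_scaled[OF u ATu] re by simp
    also have "\<alpha> * (ell2_norm (?T u))\<^sup>2 \<ge> \<alpha> * (c * ell2_norm u)\<^sup>2"
      using c by (intro mult_left_mono power_mono lowT u) (auto simp: \<alpha>_def)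
    then have "(ell2_norm u)\<^sup>2 - \<alpha> * (ell2_norm (?T u))\<^sup>2 \<le> (\<kappa> * ell2_norm u)\<^sup>2"
      unfolding power_mult_distrib \<kappa>(3) by (simp add: \<alpha>_def algebra_simps)
    finally show ?thesis
      by (rule power2_le_imp_le) (intro mult_nonneg_nonneg \<kappa>(1) ell2_norm_nonneg)
  qed
  define g where "g = (\<lambda>n. of_real \<alpha> * ?A f n)"
  have g: "g \<in> ell2"
    unfolding g_def by (intro ell2_scale(1) A f)
  define x where "x = rec_nat (\<lambda>_. 0) (\<lambda>_ u n. Q u n + g n)"
  have x0: "x 0 = (\<lambda>_. 0)" and xS: "x (Suc j) = (\<lambda>n. Q (x j) n + g n)" for j
    by (auto simp: x_def)
  have xE: "x j \<in> ell2" for j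
    by (induction j) (auto simp: x0 xS intro: ell2_finite_support ell2_add(1) QE g)
  define R where "R = ell2_norm g / (1 - \<kappa>)"
  have R: "R \<ge> 0" "\<kappa> * R + ell2_norm g = R"
    using \<kappa> by (auto simp: R_def field_simps)
  have xR: "ell2_norm (x j) \<le> R" for j
  proof (induction j)
    case 0
    then show ?case
      using R by (simp add: x0 ell2_norm_def)
  next
    case (Suc j)
    have "ell2_norm (x (Suc j)) \<le> ell2_norm (Q (x j)) + ell2_norm g"
      unfolding xS by (rule ell2_add(2)[OF QE[OF xE] g])
    also have "\<dots> \<le> \<kappa> * ell2_norm (x j) + ell2_norm g"
      using contr[OF xE] by simp
    also have "\<dots> \<le> \<kappa> * R + ell2_norm g"
      using Suc \<kappa> by (intro add_right_mono mult_left_mono) auto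
    finally show ?case
      using R by simp
  qed
  have Qd: "Q (\<lambda>n. a n - b n) = (\<lambda>n. Q a n - Q b n)" for a b
    by (simp add: Q_def shifted_op_diff algebra_simps)
  have step: "ell2_norm (\<lambda>n. x (Suc j) n - x j n) \<le> \<kappa> ^ j * ell2_norm g" for j
  proof (induction j)
    case 0
    have "Q (\<lambda>_. 0) = (\<lambda>_. 0)"
      by (rule ext) (simp add: Q_def shifted_op_altdef)
    then show ?case
      by (simp add: x0 xS)
  next
    case (Suc j)
    have "(\<lambda>n. x (Suc (Suc j)) n - x (Suc j) n) = Q (\<lambda>n. x (Suc j) n - x j n)"
      unfolding Qd by (subst xS, subst (2) xS) simp
    then have "ell2_norm (\<lambda>n. x (Suc (Suc j)) n - x (Suc j) n)
        \<le> \<kappa> * ell2_norm (\<lambda>n. x (Suc j) n - x j n)"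
      using contr[OF ell2_diff(1)[OF xE xE]] by simp
    also have "\<dots> \<le> \<kappa> * (\<kappa> ^ j * ell2_norm g)"
      using Suc \<kappa> by (intro mult_left_mono) auto
    finally show ?case
      by simp
  qed
  define y where "y = (\<lambda>n. lim (\<lambda>j. x j n))"
  have "convergent (\<lambda>j. x j n)" for n
  proof -
    have "summable (\<lambda>j. x (Suc j) n - x j n)"
    proof (rule summable_comparison_test[of _ "\<lambda>j. \<kappa> ^ j * ell2_norm g"])
      show "\<exists>N. \<forall>j\<ge>N. norm (x (Suc j) n - x j n) \<le> \<kappa> ^ j * ell2_norm g"
        using order_trans[OF ell2_coord_le[OF ell2_diff(1)[OF xE xE]] step] by blast
      show "summable (\<lambda>j. \<kappa> ^ j * ell2_norm g)"
        using \<kappa> by (intro summable_mult2 summable_geometric) auto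
    qed
    then have "convergent (\<lambda>j. \<Sum>i<j. x (Suc i) n - x i n)"
      by (simp add: summable_iff_convergent)
    moreover have "(\<lambda>j. \<Sum>i<j. x (Suc i) n - x i n) = (\<lambda>j. x j n)"
      using sum_lessThan_telescope[of "\<lambda>j. x j n"] by (auto simp: x0)
    ultimately show ?thesis
      by simp
  qed
  then have y: "(\<lambda>j. x j n) \<longlonglongrightarrow> y n" for n
    unfolding y_def convergent_LIMSEQ_iff .
  have "(\<Sum>n\<in>B. (cmod (y n))\<^sup>2) \<le> R\<^sup>2" if "finite B" for B
  proof (rule LIMSEQ_le_const2)
    show "(\<lambda>j. \<Sum>n\<in>B. (cmod (x j n))\<^sup>2) \<longlonglongrightarrow> (\<Sum>n\<in>B. (cmod (y n))\<^sup>2)"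
      by (intro tendsto_intros y)
    show "\<exists>N. \<forall>j\<ge>N. (\<Sum>n\<in>B. (cmod (x j n))\<^sup>2) \<le> R\<^sup>2"
      using order_trans[OF ell2_finite_sum_le[OF xE that] power_mono[OF xR]] by auto
  qed
  then have yE: "y \<in> ell2"
    by (intro ell2_boundI(1)[of R]) (use R in auto)
  have TT: "(\<lambda>j. ?A (?T (x j)) n) \<longlonglongrightarrow> ?A (?T y) n" for n
    unfolding shifted_op_altdef by (intro tendsto_intros y)
  have fixpoint: "y n = Q y n + g n" for n
  proof (rule LIMSEQ_unique)
    show "(\<lambda>j. x (Suc j) n) \<longlonglongrightarrow> y n"
      using y by (rule LIMSEQ_Suc)
    show "(\<lambda>j. x (Suc j) n) \<longlonglongrightarrow> Q y n + g n"
      unfolding xS Q_def by (intro tendsto_intros y TT)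
  qed
  have "of_real \<alpha> * (?A (?T y) n - ?A f n) = y n - (Q y n + g n)" for n
    by (simp add: Q_def g_def algebra_simps)
  then have "of_real \<alpha> * (?A (?T y) n - ?A f n) = 0" for n
    by (simp only: fixpoint[symmetric] diff_self)
  then have "?A (\<lambda>n. ?T y n - f n) = (\<lambda>_. 0)"
    using K unfolding shifted_op_diff by (auto simp: \<alpha>_def)
  moreover have d: "(\<lambda>n. ?T y n - f n) \<in> ell2"
    by (intro ell2_diff(1) T yE f)
  ultimately have "c * ell2_norm (\<lambda>n. ?T y n - f n) \<le> 0"
    using lowA[OF d] by (simp add: ell2_norm_def)
  then have "ell2_norm (\<lambda>n. ?T y n - f n) \<le> 0"
    using c by (simp add: mult_le_0_iff)
  then have "?T y n - f n = 0" for n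
    using ell2_norm_le_zeroD[OF d] by blast
  then have "?T y = f"
    by auto
  with yE show ?thesis
    by blast
qed

text \<open>Since \<open>H\<close> is self-adjoint with real coefficients, a lower bound for \<open>H - z\<close> is also one for its
  adjoint, and therefore suffices for surjectivity.\<close>

lemma not_in_ell2_spectrum_iff:
  assumes V: "potential_bound v \<omega> V"
  shows "z \<notin> ell2_spectrum (schroedinger v \<omega>) \<longleftrightarrow> (\<exists>c>0. bounded_below v \<omega> z c)"
proof
  assume "z \<notin> ell2_spectrum (schroedinger v \<omega>)"
  then obtain R where R: "bounded_ell2_operator R"
    and inv: "\<And>u. u \<in> ell2 \<Longrightarrow> R (shifted_op v \<omega> z u) = u"
    unfolding ell2_spectrum_def shifted_op_def by auto
  obtain K where K: "\<And>u. u \<in> ell2 \<Longrightarrow> ell2_norm (R u) \<le> K * ell2_norm u"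
    using R unfolding bounded_ell2_operator_def by (elim conjE exE) (rule that, blast)
  have "bounded_below v \<omega> z (1 / max K 1)"
    unfolding bounded_below_def
  proof (intro allI impI)
    fix u :: "int \<Rightarrow> complex"
    assume "finite {n. u n \<noteq> 0}"
    then have u: "u \<in> ell2"
      by (rule ell2_finite_support)
    have "ell2_norm u \<le> K * ell2_norm (shifted_op v \<omega> z u)"
      using K[OF shifted_op_ell2(1)[OF u V, of z]] inv[OF u] by simp
    also have "\<dots> \<le> max K 1 * ell2_norm (shifted_op v \<omega> z u)"
      by (intro mult_right_mono) auto
    finally show "1 / max K 1 * ell2_norm u \<le> ell2_norm (shifted_op v \<omega> z u)"
      by (simp add: field_simps)
  qed
  then show "\<exists>c>0. bounded_below v \<omega> z c"
    by (intro exI[of _ "1 / max K 1"]) auto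
next
  assume "\<exists>c>0. bounded_below v \<omega> z c"
  then obtain c where c: "c > 0" and below: "bounded_below v \<omega> z c"
    by auto
  let ?T = "shifted_op v \<omega> z"
  have low: "c * ell2_norm u \<le> ell2_norm (?T u)" if "u \<in> ell2" for u
    by (rule bounded_below_ell2[OF below _ that V]) (use c in auto)
  have inj: "u = w" if u: "u \<in> ell2" and w: "w \<in> ell2" and eq: "?T u = ?T w" for u w
  proof -
    have d: "(\<lambda>n. u n - w n) \<in> ell2"
      by (rule ell2_diff(1)[OF u w])
    have "c * ell2_norm (\<lambda>n. u n - w n) \<le> 0"
      using low[OF d] eq by (simp add: shifted_op_diff ell2_norm_def)
    then have "ell2_norm (\<lambda>n. u n - w n) \<le> 0"
      using c by (simp add: mult_le_0_iff)
    then have "u n - w n = 0" for n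
      using ell2_norm_le_zeroD[OF d] by blast
    then show ?thesis
      by auto
  qed
  define R where "R = (\<lambda>f. SOME u. u \<in> ell2 \<and> ?T u = f)"
  have R: "R f \<in> ell2" "?T (R f) = f" if "f \<in> ell2" for f
    using someI_ex[of "\<lambda>u. u \<in> ell2 \<and> ?T u = f"] shifted_op_surj[OF below c that V]
    unfolding R_def by auto
  have "bounded_ell2_operator R"
    unfolding bounded_ell2_operator_def
  proof (intro conjI ballI allI)
    fix u w :: "int \<Rightarrow> complex" and a b :: complex
    assume u: "u \<in> ell2" and w: "w \<in> ell2"
    have l: "(\<lambda>n. a * u n + b * w n) \<in> ell2" and r: "(\<lambda>n. a * R u n + b * R w n) \<in> ell2"
      by (intro ell2_add(1) ell2_scale(1) R u w)+
    show "R (\<lambda>n. a * u n + b * w n) = (\<lambda>n. a * R u n + b * R w n)"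
      by (rule inj[OF R(1)[OF l] r]) (simp only: shifted_op_lincomb R(2)[OF l] R(2)[OF u] R(2)[OF w])
  next
    show "\<exists>K. \<forall>u\<in>ell2. ell2_norm (R u) \<le> K * ell2_norm u"
    proof (intro exI[of _ "1 / c"] ballI)
      fix u
      assume "u \<in> ell2"
      then show "ell2_norm (R u) \<le> 1 / c * ell2_norm u"
        using low[of "R u"] R c by (simp add: field_simps)
    qed
  qed (rule R)
  moreover have "R (?T u) = u \<and> ?T (R u) = u" if u: "u \<in> ell2" for u
    using R(2)[OF u] inj[OF R(1) u R(2)] shifted_op_ell2(1)[OF u V] by simp
  ultimately show "z \<notin> ell2_spectrum (schroedinger v \<omega>)"
    unfolding ell2_spectrum_def shifted_op_def by auto
qed

text \<open>If every finite pattern of \<open>\<omega>'\<close> occurs in \<open>\<omega>\<close>, a test sequence for \<open>\<omega>'\<close> can be translated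
  to a test sequence for \<open>\<omega>\<close> with the same norms.\<close>

lemma bounded_below_local:
  assumes occ: "\<And>m::nat. \<exists>a. \<forall>i. \<bar>i\<bar> \<le> int m \<longrightarrow> \<omega>' i = \<omega> (i + a)"
    and "bounded_below v \<omega> z c"
  shows "bounded_below v \<omega>' z c"
  unfolding bounded_below_def
proof (intro allI impI)
  fix u :: "int \<Rightarrow> complex"
  assume fin: "finite {n. u n \<noteq> 0}"
  then have "finite ((\<lambda>n. nat \<bar>n\<bar>) ` {n. u n \<noteq> 0})"
    by simp
  then obtain m where m: "\<forall>x\<in>(\<lambda>n. nat \<bar>n\<bar>) ` {n. u n \<noteq> 0}. x \<le> m"
    using finite_nat_set_iff_bounded_le by auto
  then have supp: "u n = 0" if "\<bar>n\<bar> > int m" for n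
    using that by force
  obtain a where a: "\<And>i. \<bar>i\<bar> \<le> int m \<Longrightarrow> \<omega>' i = \<omega> (i + a)"
    using occ by meson
  let ?w = "\<lambda>n. u (n + (-a))"
  have "finite {n. ?w n \<noteq> 0}"
    by (rule finite_surj[OF fin, of _ "\<lambda>n. n + a"]) force
  then have "c * ell2_norm ?w \<le> ell2_norm (shifted_op v \<omega> z ?w)"
    using assms(2)[unfolded bounded_below_def, rule_format, of ?w] by blast
  moreover have "shifted_op v \<omega>' z u = (\<lambda>n. shifted_op v \<omega> z ?w (n + a))"
  proof (rule ext)
    fix n
    show "shifted_op v \<omega>' z u n = shifted_op v \<omega> z ?w (n + a)"
      using supp[of n] a[of n] by (cases "\<bar>n\<bar> \<le> int m") (auto simp: shifted_op_altdef algebra_simps)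
  qed
  ultimately show "c * ell2_norm u \<le> ell2_norm (shifted_op v \<omega>' z u)"
    using ell2_translate(2)[of "shifted_op v \<omega> z ?w" a] ell2_translate(2)[of u "-a"] by simp
qed

lemma closed_ell2_spectrum:
  assumes V: "potential_bound v \<omega> V"
  shows "closed (complex_of_real -` ell2_spectrum (schroedinger v \<omega>))"
proof -
  have "open (- ell2_spectrum (schroedinger v \<omega>))"
  proof (rule Topological_Spaces.openI)
    fix z
    assume "z \<in> - ell2_spectrum (schroedinger v \<omega>)"
    then obtain c where c: "c > 0" and below: "bounded_below v \<omega> z c"
      using not_in_ell2_spectrum_iff[OF V, of z] by auto
    have "z' \<notin> ell2_spectrum (schroedinger v \<omega>)" if z': "cmod (z' - z) < c" for z'
    proof -
      have "bounded_below v \<omega> z' (c - cmod (z' - z))"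
        unfolding bounded_below_def
      proof (intro allI impI)
        fix u :: "int \<Rightarrow> complex"
        assume fin: "finite {n. u n \<noteq> 0}"
        then have u: "u \<in> ell2"
          by (rule ell2_finite_support)
        have "shifted_op v \<omega> z u = (\<lambda>n. shifted_op v \<omega> z' u n + (z' - z) * u n)"
          by (rule ext) (simp add: shifted_op_def algebra_simps)
        then have "ell2_norm (shifted_op v \<omega> z u)
            \<le> ell2_norm (shifted_op v \<omega> z' u) + cmod (z' - z) * ell2_norm u"
          using ell2_add(2)[OF shifted_op_ell2(1)[OF u V] ell2_scale(1)[OF u]] ell2_scale(2)[OF u]
          by metis
        moreover have "c * ell2_norm u \<le> ell2_norm (shifted_op v \<omega> z u)"
          using below fin by (simp add: bounded_below_def)
        ultimately show "(c - cmod (z' - z)) * ell2_norm u \<le> ell2_norm (shifted_op v \<omega> z' u)"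
          by (simp add: algebra_simps)
      qed
      then show ?thesis
        using not_in_ell2_spectrum_iff[OF V, of z'] z' by (metis diff_gt_0_iff_gt)
    qed
    then show "\<exists>T. open T \<and> z \<in> T \<and> T \<subseteq> - ell2_spectrum (schroedinger v \<omega>)"
      using c by (intro exI[of _ "ball z c"]) (auto simp: dist_norm norm_minus_commute)
  qed
  then have "closed (ell2_spectrum (schroedinger v \<omega>))"
    by (simp add: closed_def)
  then show ?thesis
    by (rule continuous_closed_vimage) (auto intro!: continuous_intros)
qed


section \<open>Transfer matrices and discriminants\<close>

definition transfer_step :: "'a::comm_ring_1 \<Rightarrow> 'a \<Rightarrow> 'a^2^2" where
  "transfer_step E x = vector [vector [E - x, -1], vector [1, 0]]"

text \<open>For a solution \<open>u\<close> of \<open>u (n + 1) + u (n - 1) + v (\<omega> n) u n = E u n\<close> this matrix maps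
  \<open>(u n, u (n - 1))\<close> across the word; the first letter acts first. The entries are taken in an
  arbitrary commutative ring, since real and complex energies and the indeterminate energy of a
  polynomial ring all occur.\<close>

primrec transfer :: "'a::comm_ring_1 \<Rightarrow> ('b \<Rightarrow> 'a) \<Rightarrow> 'b list \<Rightarrow> 'a^2^2" where
  "transfer E v [] = mat 1"
| "transfer E v (x # w) = transfer E v w ** transfer_step E (v x)"

lemma transfer_append: "transfer E v (xs @ ys) = transfer E v ys ** transfer E v xs"
  by (induction xs) (simp_all add: matrix_mul_assoc)

lemma det_transfer: "det (transfer E v w) = 1"
proof (induction w)
  case (Cons x w)
  have "det (transfer_step E (v x)) = 1"
    by (simp add: det_2 transfer_step_def)
  with Cons show ?case
    by (simp add: det_mul)
qed simp

text \<open>The Cayley-Hamilton identity for \<open>A\<close>, multiplied by \<open>X\<close>.\<close>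

lemma trace_mult_square:
  fixes A X :: "'a::comm_ring_1^2^2"
  shows "trace (X ** A ** A) = trace A * trace (X ** A) - det A * trace X"
  by (simp add: trace_def sum_2 matrix_matrix_mult_def det_2 algebra_simps)

lemma transfer_hom:
  fixes h :: "'a::comm_ring_1 \<Rightarrow> 'c::comm_ring_1"
  assumes "\<And>x y. h (x + y) = h x + h y" "\<And>x y. h (x * y) = h x * h y" "h 1 = 1"
  shows "transfer (h E) (\<lambda>x. h (v x)) w $ i $ j = h (transfer E v w $ i $ j)"
proof -
  have h0: "h 0 = 0"
    using assms(1)[of 0 0] by simp
  have hm: "h (- x) = - h x" for x
    using assms(1)[of x "- x"] h0 by (simp add: eq_neg_iff_add_eq_0 add.commute)
  have hd: "h (x - y) = h x - h y" for x y
    using assms(1)[of x "- y"] hm by simp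
  have "\<forall>i j. transfer (h E) (\<lambda>x. h (v x)) w $ i $ j = h (transfer E v w $ i $ j)"
    by (induction w)
       (simp_all add: forall_2 matrix_matrix_mult_def sum_2 transfer_step_def mat_def assms h0 hm hd)
  then show ?thesis
    by blast
qed

definition disc :: "('b \<Rightarrow> real) \<Rightarrow> 'b list \<Rightarrow> real \<Rightarrow> real" where
  "disc v w E = trace (transfer E v w)"

text \<open>For the periodic potential that repeats \<open>w\<close>, these energies belong to the spectrum, and all
  but finitely many energies of the spectrum are among them.\<close>

definition band :: "('b \<Rightarrow> real) \<Rightarrow> 'b list \<Rightarrow> real set" where
  "band v w = {E. \<bar>disc v w E\<bar> < 2}"

definition disc_poly :: "('b \<Rightarrow> 'a::comm_ring_1) \<Rightarrow> 'b list \<Rightarrow> 'a poly" where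
  "disc_poly v w = trace (transfer [:0, 1:] (\<lambda>x. [:v x:]) w)"

lemma poly_disc_poly: "poly (disc_poly v w) E = trace (transfer E v w)"
  using transfer_hom[of "\<lambda>p. poly p E" "[:0, 1:]" "\<lambda>x. [:v x:]" w]
  by (simp add: disc_poly_def trace_def sum_2)

lemma trace_transfer_of_real:
  "trace (transfer (complex_of_real E) (\<lambda>x. of_real (v x)) w) = of_real (disc v w E)"
  using transfer_hom[of complex_of_real E v w] by (simp add: trace_def disc_def sum_2)

text \<open>As a polynomial in the energy, the upper left entry is monic of degree \<open>length w\<close> and
  dominates the other entries. The exception \<open>m > 0\<close> is caused by the identity matrix of the
  empty word.\<close>

lemma coeff_transfer_poly:
  fixes v :: "'b \<Rightarrow> 'a::comm_ring_1" and w :: "'b list"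
  defines "M \<equiv> transfer [:0, 1:] (\<lambda>x. [:v x:]) w"
  shows "coeff (M $ 1 $ 1) (length w) = 1 \<and> (\<forall>m>length w. coeff (M $ 1 $ 1) m = 0)
    \<and> (\<forall>m\<ge>length w. coeff (M $ 1 $ 2) m = 0) \<and> (\<forall>m\<ge>length w. coeff (M $ 2 $ 1) m = 0)
    \<and> (\<forall>m\<ge>length w. m > 0 \<longrightarrow> coeff (M $ 2 $ 2) m = 0)"
  unfolding M_def
proof (induction w)
  case Nil
  then show ?case
    by (auto simp: mat_def coeff_pCons split: nat.splits)
next
  case (Cons x w)
  let ?M = "transfer [:0, 1:] (\<lambda>x. [:v x:]) w"
  have *: "coeff (p * ([:0, 1:] - [:v x:])) m = (case m of 0 \<Rightarrow> 0 | Suc m' \<Rightarrow> coeff p m') - v x * coeff p m"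
    for p :: "'a poly" and m
    by (simp add: algebra_simps coeff_pCons split: nat.splits)
  show ?case
    using Cons
    by (auto simp: matrix_matrix_mult_def sum_2 transfer_step_def * split: nat.splits simp del: diff_pCons)
qed

lemma coeff_disc_poly: "w \<noteq> [] \<Longrightarrow> coeff (disc_poly v w) (length w) = 1"
  using coeff_transfer_poly[of v w] by (simp add: disc_poly_def trace_def sum_2)

lemma degree_disc_poly_pos:
  assumes "w \<noteq> []"
  shows "degree (disc_poly v w) > 0"
proof -
  have "length w \<le> degree (disc_poly v w)"
    by (rule le_degree) (simp add: coeff_disc_poly[OF assms])
  with assms show ?thesis
    by (cases w) auto
qed

lemma disc_eq_poly: "disc v w E = poly (disc_poly v w) E"
  by (simp add: disc_def poly_disc_poly)

lemma continuous_on_disc: "continuous_on UNIV (disc v w)"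
  unfolding disc_eq_poly by (intro continuous_intros)

lemma open_band: "open (band v w)"
  unfolding band_def by (intro open_Collect_less continuous_intros continuous_on_disc)

lemma sets_band [measurable]: "band v w \<in> sets borel"
  by (rule borel_open[OF open_band])

lemma finite_disc_level: "w \<noteq> [] \<Longrightarrow> finite {E. disc v w E = c}"
proof -
  assume w: "w \<noteq> []"
  let ?p = "disc_poly v w - [:c:]"
  have "coeff ?p (length w) = 1"
    using w coeff_disc_poly[OF w, of v] by (cases w) auto
  then have "finite {E. poly ?p E = 0}"
    by (intro poly_roots_finite) auto
  then show ?thesis
    by (simp add: disc_eq_poly)
qed

lemma bounded_band: "w \<noteq> [] \<Longrightarrow> bounded (band v w)"
proof -
  assume w: "w \<noteq> []"
  obtain a q where aq: "disc_poly v w = pCons a q"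
    by (cases "disc_poly v w") auto
  with degree_disc_poly_pos[OF w, of v] have "q \<noteq> 0"
    by auto
  then obtain r where "\<And>z. r \<le> norm z \<Longrightarrow> 2 \<le> norm (poly (disc_poly v w) z)"
    using poly_infinity[of q 2 a] unfolding aq by blast
  then have "band v w \<subseteq> cball 0 r"
    unfolding band_def disc_eq_poly by (force simp: subset_eq not_le[symmetric])
  then show ?thesis
    using bounded_cball bounded_subset by blast
qed


section \<open>Bloch waves\<close>

lemma eigenvector_2:
  fixes A :: "complex^2^2"
  assumes "l\<^sup>2 - trace A * l + 1 = 0" and "det A = 1"
  obtains x y where "x \<noteq> 0 \<or> y \<noteq> 0"
    and "A $ 1 $ 1 * x + A $ 1 $ 2 * y = l * x" and "A $ 2 $ 1 * x + A $ 2 $ 2 * y = l * y"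
proof -
  define a b c d where abcd: "a = A $ 1 $ 1" "b = A $ 1 $ 2" "c = A $ 2 $ 1" "d = A $ 2 $ 2"
  have ch: "(l - a) * (l - d) = b * c"
  proof -
    have 1: "l\<^sup>2 - (a + d) * l + 1 = 0"
      using assms(1) by (simp add: trace_def sum_2 abcd)
    have 2: "a * d - b * c = 1"
      using assms(2) by (simp add: det_2 abcd)
    show ?thesis
      using 1 2 by algebra
  qed
  consider "b \<noteq> 0 \<or> l - a \<noteq> 0" | "b = 0" "l = a" "l - d \<noteq> 0 \<or> c \<noteq> 0" | "b = 0" "l = a" "l = d" "c = 0"
    by auto
  then show ?thesis
  proof cases
    case 1
    then show ?thesis
      using ch by (intro that[of b "l - a"]) (simp_all add: abcd[symmetric] algebra_simps)
  next
    case 2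
    then show ?thesis
      by (intro that[of "l - d" c]) (simp_all add: abcd[symmetric] algebra_simps)
  next
    case 3
    then show ?thesis
      by (intro that[of 1 0]) (simp_all add: abcd[symmetric])
  qed
qed

text \<open>The value \<open>f (i + 1)\<close> belongs to the \<open>i\<close>-th site, so that \<open>f 0\<close> is the value just before the
  first letter and no negative index is needed.\<close>

definition bloch_wave :: "('b \<Rightarrow> real) \<Rightarrow> 'b list \<Rightarrow> complex \<Rightarrow> complex \<Rightarrow> (nat \<Rightarrow> complex) \<Rightarrow> bool" where
  "bloch_wave v w E l f \<longleftrightarrow>
     (\<forall>i. f (i + 2) = (E - of_real (v (w ! (i mod length w)))) * f (i + 1) - f i) \<and>
     (\<forall>i. f (i + length w) = l * f i) \<and> (\<exists>i<length w. f (i + 1) \<noteq> 0)"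

lemma bloch_wave_exists:
  fixes v :: "'b \<Rightarrow> real"
  assumes w: "w \<noteq> []" and l: "l\<^sup>2 - trace (transfer E (\<lambda>x. of_real (v x)) w) * l + 1 = 0"
  shows "\<exists>f. bloch_wave v w E l f"
proof -
  let ?v = "\<lambda>x. complex_of_real (v x)" and ?p = "length w"
  let ?A = "transfer E ?v w"
  obtain x y where xy: "x \<noteq> 0 \<or> y \<noteq> 0" "?A $ 1 $ 1 * x + ?A $ 1 $ 2 * y = l * x"
    "?A $ 2 $ 1 * x + ?A $ 2 $ 2 * y = l * y"
    using eigenvector_2[OF l det_transfer] by metis
  define g where "g = rec_nat (y, x) (\<lambda>i (a, b). (b, (E - ?v (w ! (i mod ?p))) * b - a))"
  define f where "f = (\<lambda>i. fst (g i))"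
  have g0: "g 0 = (y, x)"
    and gS: "g (Suc i) = (snd (g i), (E - ?v (w ! (i mod ?p))) * snd (g i) - fst (g i))" for i
    by (auto simp: g_def split: prod.splits)
  have gt: "snd (g i) = transfer E ?v (take i w) $ 1 $ 1 * x + transfer E ?v (take i w) $ 1 $ 2 * y
      \<and> fst (g i) = transfer E ?v (take i w) $ 2 $ 1 * x + transfer E ?v (take i w) $ 2 $ 2 * y"
    if "i \<le> ?p" for i
    using that
  proof (induction i)
    case 0
    then show ?case
      by (simp add: g0 mat_def)
  next
    case (Suc i)
    then have "take (Suc i) w = take i w @ [w ! i]"
      by (simp add: take_Suc_conv_app_nth)
    then show ?case
      using Suc by (simp add: gS transfer_append matrix_matrix_mult_def sum_2 transfer_step_def mat_def algebra_simps)
  qed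
  have gp: "g (i + ?p) = (l * fst (g i), l * snd (g i))" for i
  proof (induction i)
    case 0
    then show ?case
      using gt[of ?p] xy by (simp add: g0 prod_eq_iff)
  next
    case (Suc i)
    then show ?case
      by (simp add: gS algebra_simps)
  qed
  have "f (i + 2) = (E - ?v (w ! (i mod ?p))) * f (i + 1) - f i" for i
    by (simp add: f_def gS)
  moreover have per: "f (i + ?p) = l * f i" for i
    by (simp add: f_def gp)
  moreover have "\<exists>i<?p. f (i + 1) \<noteq> 0"
  proof (rule ccontr)
    assume "\<not> ?thesis"
    then have z: "f (i + 1) = 0" if "i < ?p" for i
      using that by blast
    have "f 1 = x" "f 0 = y"
      by (simp_all add: f_def gS g0)
    moreover have "f 1 = 0"
      using z[of 0] w by simp
    moreover have "f ?p = 0"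
      using z[of "?p - 1"] w by (simp add: Suc_leI)
    moreover have "l \<noteq> 0"
      using l by auto
    ultimately show False
      using per[of 0] xy(1) by simp
  qed
  ultimately show ?thesis
    unfolding bloch_wave_def by blast
qed

text \<open>The imaginary part of \<open>cnj (f i) * f (i + 1)\<close> (the current) changes by \<open>Im E |f (i + 1)|\<^sup>2\<close>
  at each site, but returns to its initial value after one period when the multiplier has
  modulus 1.\<close>

lemma bloch_wave_energy_real:
  assumes "bloch_wave v w E l f" and l: "cmod l = 1"
  shows "Im E = 0"
proof -
  let ?p = "length w"
  define c where "c = (\<lambda>i. cnj (f i) * f (i + 1))"
  have f: "f (i + 2) = (E - of_real (v (w ! (i mod ?p)))) * f (i + 1) - f i"
    and per: "f (i + ?p) = l * f i" for i
    using assms(1) by (auto simp: bloch_wave_def)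
  have im: "Im E * (cmod (f (i + 1)))\<^sup>2 = Im (c (Suc i)) - Im (c i)" for i
  proof -
    have "c (Suc i) = cnj (f (i + 1)) * ((E - of_real (v (w ! (i mod ?p)))) * f (i + 1) - f i)"
      using f[of i] by (simp add: c_def)
    then have "c (Suc i) = E * (cnj (f (i + 1)) * f (i + 1))
        - of_real (v (w ! (i mod ?p))) * (cnj (f (i + 1)) * f (i + 1)) - cnj (c i)"
      by (simp add: c_def algebra_simps)
    moreover have "cnj (f (i + 1)) * f (i + 1) = of_real ((cmod (f (i + 1)))\<^sup>2)"
      by (metis complex_norm_square mult.commute)
    ultimately show ?thesis
      by simp
  qed
  have "c (0 + ?p) = (cnj l * l) * c 0"
    unfolding c_def using per[of 0] per[of 1] by (simp add: algebra_simps)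
  also have "cnj l * l = 1"
    using l by (metis complex_norm_square mult.commute of_real_1 one_power2)
  finally have "c ?p = c 0"
    by simp
  have "Im E * (\<Sum>i<?p. (cmod (f (i + 1)))\<^sup>2) = (\<Sum>i<?p. Im (c (Suc i)) - Im (c i))"
    unfolding sum_distrib_left by (rule sum.cong) (simp_all only: im)
  also have "\<dots> = Im (c ?p) - Im (c 0)"
    by (rule sum_lessThan_telescope)
  also have "\<dots> = 0"
    using \<open>c ?p = c 0\<close> by simp
  finally have "Im E = 0 \<or> (\<Sum>i<?p. (cmod (f (i + 1)))\<^sup>2) = 0"
    by simp
  moreover obtain i where "i < ?p" "f (i + 1) \<noteq> 0"
    using assms(1) by (auto simp: bloch_wave_def)
  then have "(\<Sum>i<?p. (cmod (f (i + 1)))\<^sup>2) \<noteq> 0"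
    by (subst sum_nonneg_eq_0_iff) auto
  ultimately show ?thesis
    by blast
qed

text \<open>A complex root of the discriminant exists by the fundamental theorem of algebra. The
  multipliers there are \<open>\<plusminus> \<i>\<close>, so there is a Bloch wave with multiplier of modulus 1, and the root is
  real.\<close>

lemma disc_has_real_root:
  assumes "w \<noteq> []"
  shows "\<exists>E. disc v w E = 0"
proof -
  let ?v = "\<lambda>x. complex_of_real (v x)"
  have "\<not> constant (poly (disc_poly ?v w))"
    using degree_disc_poly_pos[OF assms, of ?v] by (simp add: constant_degree)
  then obtain z where "poly (disc_poly ?v w) z = 0"
    using fundamental_theorem_of_algebra by blast
  then have z: "trace (transfer z ?v w) = 0"
    by (simp add: poly_disc_poly)
  then obtain f where "bloch_wave v w z \<i> f"
    using bloch_wave_exists[OF assms, of \<i> z v] by auto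
  then have "Im z = 0"
    by (rule bloch_wave_energy_real) simp
  then have "z = of_real (Re z)"
    by (simp add: complex_eq_iff)
  then have "of_real (disc v w (Re z)) = (0 :: complex)"
    using z trace_transfer_of_real[of "Re z" v w] by simp
  then show ?thesis
    by auto
qed

lemma emeasure_band_pos:
  assumes "w \<noteq> []"
  shows "emeasure lborel (band v w) > 0"
proof -
  obtain E where "disc v w E = 0"
    using disc_has_real_root[OF assms, of v] ..
  then have "E \<in> band v w"
    by (simp add: band_def)
  then obtain e where e: "e > 0" "ball E e \<subseteq> band v w"
    using open_band open_contains_ball by metis
  have "{E - e<..<E + e} \<subseteq> band v w"
    using e by (auto simp: subset_eq dist_real_def abs_diff_less_iff)
  then have "emeasure lborel {E - e<..<E + e} \<le> emeasure lborel (band v w)"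
    by (intro emeasure_mono) (auto simp: sets_band)
  moreover have "emeasure lborel {E - e<..<E + e} > 0"
    using e(1) by simp
  ultimately show ?thesis
    by (rule less_le_trans[rotated])
qed

lemma ell2_delta:
  "(\<lambda>n. if n = b then x else 0) \<in> ell2" "ell2_norm (\<lambda>n. if n = b then x else 0) = cmod x"
proof -
  have "(ell2_norm (\<lambda>n. if n = b then x else 0))\<^sup>2 = (cmod x)\<^sup>2"
    by (subst ell2_norm_sq_finite_support[of "{b}"]) auto
  then show "ell2_norm (\<lambda>n. if n = b then x else 0) = cmod x"
    by simp
qed (auto intro: ell2_finite_support)

lemma sum_periodic:
  fixes g :: "nat \<Rightarrow> real"
  assumes "\<And>i. g (i + p) = g i"
  shows "(\<Sum>i<N * p. g i) = real N * (\<Sum>i<p. g i)"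
proof (induction N)
  case (Suc N)
  have shift: "g (i + N * p) = g i" for i
  proof (induction N)
    case (Suc N)
    then show ?case
      using assms[of "i + N * p"] by (simp add: algebra_simps)
  qed simp
  have "(\<Sum>i<Suc N * p. g i) = (\<Sum>i=0..<N * p. g i) + (\<Sum>i=0 + N * p..<p + N * p. g i)"
    using sum.atLeastLessThan_concat[of 0 "N * p" "p + N * p" g] by (simp add: lessThan_atLeast0)
  also have "(\<Sum>i=0 + N * p..<p + N * p. g i) = (\<Sum>i=0..<p. g i)"
    unfolding sum.shift_bounds_nat_ivl shift ..
  finally show ?case
    using Suc by (simp add: lessThan_atLeast0 algebra_simps)
qed simp

text \<open>The Bloch wave cut off to \<open>N\<close> periods has squared norm \<open>N P\<close>, where \<open>P\<close> is the contribution of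
  one period, while the error made by the cut-off is a sum of four point masses of size at most
  \<open>sqrt P\<close>.\<close>

lemma approximate_eigenvector_in_power:
  assumes E: "E \<in> band v w" and w: "w \<noteq> []"
    and occ: "\<And>i. i < N * length w \<Longrightarrow> \<omega> (a + int i) = w ! (i mod length w)"
    and below: "bounded_below v \<omega> (of_real E) c" and c: "c \<ge> 0"
  shows "c\<^sup>2 * real N \<le> 16"
proof (cases "N = 0")
  case False
  let ?p = "length w"
  define L where "L = N * ?p"
  have L: "L > 0"
    using False w by (simp add: L_def)
  define t where "t = disc v w E"
  define l where "l = Complex (t / 2) (sqrt (1 - (t / 2)\<^sup>2))"
  have "\<bar>t / 2\<bar> \<le> 1"
    using E by (simp add: t_def band_def)
  then have "(t / 2)\<^sup>2 \<le> 1"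
    by (simp add: abs_square_le_1)
  then have sq: "(sqrt (1 - (t / 2)\<^sup>2))\<^sup>2 = 1 - (t / 2)\<^sup>2"
    by simp
  then have l1: "cmod l = 1"
    by (simp add: l_def cmod_def)
  have "l\<^sup>2 - of_real t * l + 1 = 0"
    using sq by (simp add: l_def complex_eq_iff power2_eq_square field_simps)
  then obtain f where bloch: "bloch_wave v w (of_real E) l f"
    using bloch_wave_exists[OF w, of l "of_real E" v] trace_transfer_of_real[of E v w]
    by (auto simp: t_def)
  then have f: "f (i + 2) = (of_real E - of_real (v (w ! (i mod ?p)))) * f (i + 1) - f i"
    and per: "cmod (f (i + ?p)) = cmod (f i)" for i
    using l1 by (auto simp: bloch_wave_def norm_mult)
  define P where "P = (\<Sum>i<?p. (cmod (f (i + 1)))\<^sup>2)"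
  obtain i0 where "i0 < ?p" "f (i0 + 1) \<noteq> 0"
    using bloch by (auto simp: bloch_wave_def)
  then have P: "P > 0"
    unfolding P_def by (intro sum_pos2[of _ i0]) auto
  have le: "cmod (f j) \<le> sqrt P" for j
  proof -
    have "\<exists>i<?p. cmod (f j) = cmod (f (i + 1))"
    proof (induction j rule: less_induct)
      case (less j)
      consider "j = 0" | "0 < j" "j \<le> ?p" | "j > ?p"
        by linarith
      then show ?case
      proof cases
        case 1
        then show ?thesis
          using per[of 0] w by (intro exI[of _ "?p - 1"]) auto
      next
        case 2
        then show ?thesis
          by (intro exI[of _ "j - 1"]) auto
      next
        case 3
        then show ?thesis
          using less[of "j - ?p"] per[of "j - ?p"] w by auto
      qed
    qed
    then obtain i where i: "i < ?p" "cmod (f j) = cmod (f (i + 1))"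
      by auto
    have "(cmod (f (i + 1)))\<^sup>2 \<le> P"
      unfolding P_def using i(1) by (intro member_le_sum) auto
    then show ?thesis
      unfolding i(2) by (rule real_le_rsqrt)
  qed
  define u where "u = (\<lambda>m. if a \<le> m \<and> m < a + int L then f (nat (m - a) + 1) else 0)"
  have fin: "finite {m. u m \<noteq> 0}"
    by (rule finite_subset[of _ "{a..<a + int L}"]) (auto simp: u_def split: if_splits)
  have "(ell2_norm u)\<^sup>2 = (\<Sum>m\<in>{a..<a + int L}. (cmod (u m))\<^sup>2)"
    by (rule ell2_norm_sq_finite_support) (auto simp: u_def)
  also have "\<dots> = (\<Sum>i<L. (cmod (f (i + 1)))\<^sup>2)"
    by (rule sum.reindex_bij_witness[of _ "\<lambda>i. a + int i" "\<lambda>m. nat (m - a)"]) (auto simp: u_def)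
  also have "\<dots> = real N * P"
    unfolding L_def P_def by (rule sum_periodic) (use per[of "_ + 1"] in \<open>simp add: add.commute add.left_commute\<close>)
  finally have nu: "(ell2_norm u)\<^sup>2 = real N * P" .
  \<comment> \<open>Cutting off the Bloch wave leaves an error at the two ends only.\<close>
  let ?d = "\<lambda>b x n. if n = b then x else 0"
  have Tu: "shifted_op v \<omega> (of_real E) u =
      (\<lambda>n. (?d (a - 1) (f 1) n + ?d a (- f 0) n)
           + (?d (a + int L - 1) (- f (L + 1)) n + ?d (a + int L) (f L) n))"
  proof (rule ext)
    fix m :: int
    have sL: "Suc (nat (int L - 1)) = L"
      using L by simp
    consider "m < a - 1" | "m = a - 1" | "a \<le> m" "m < a + int L" | "m = a + int L" | "m > a + int L"
      by linarith
    then show "shifted_op v \<omega> (of_real E) u m =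
      (?d (a - 1) (f 1) m + ?d a (- f 0) m)
           + (?d (a + int L - 1) (- f (L + 1)) m + ?d (a + int L) (f L) m)"
    proof cases
      case 3
      define i where "i = nat (m - a)"
      have i: "m = a + int i" "i < L"
        using 3 by (auto simp: i_def)
      have 1: "u m = f (i + 1)"
        using i by (simp add: u_def)
      have 2: "u (m + 1) = f (i + 2) - ?d (a + int L - 1) (f (L + 1)) m"
      proof (cases "i + 1 = L")
        case True
        then have "m + 1 = a + int L" "m = a + int L - 1"
          using i by auto
        then show ?thesis
          using True by (simp add: u_def flip: Suc_eq_plus1)
      next
        case False
        then show ?thesis
          using i by (auto simp: u_def nat_add_distrib)
      qed
      have 3: "u (m - 1) = f i - ?d a (f 0) m"
        using i by (cases i) (auto simp: u_def)
      have 4: "\<omega> m = w ! (i mod ?p)"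
        using occ[of i] i by (simp add: L_def)
      show ?thesis
        unfolding shifted_op_altdef 1 2 3 4 f[of i] using i by (auto simp: algebra_simps)
    qed (use L sL in \<open>auto simp: shifted_op_altdef u_def\<close>)
  qed
  have "ell2_norm (shifted_op v \<omega> (of_real E) u) \<le> (cmod (f 1) + cmod (f 0)) + (cmod (f (L + 1)) + cmod (f L))"
    unfolding Tu
    using ell2_add(2)[OF ell2_add(1)[OF ell2_delta(1) ell2_delta(1)] ell2_add(1)[OF ell2_delta(1) ell2_delta(1)],
        of "a - 1" "f 1" a "- f 0" "a + int L - 1" "- f (L + 1)" "a + int L" "f L"]
      ell2_add(2)[OF ell2_delta(1) ell2_delta(1), of "a - 1" "f 1" a "- f 0"]
      ell2_add(2)[OF ell2_delta(1) ell2_delta(1), of "a + int L - 1" "- f (L + 1)" "a + int L" "f L"]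
    by (simp add: ell2_delta(2))
  also have "\<dots> \<le> 4 * sqrt P"
    using le[of 1] le[of 0] le[of "L + 1"] le[of L] by linarith
  finally have "c * ell2_norm u \<le> 4 * sqrt P"
    using below fin by (auto simp: bounded_below_def)
  then have "(c * ell2_norm u)\<^sup>2 \<le> (4 * sqrt P)\<^sup>2"
    using c by (intro power_mono) auto
  then have "c\<^sup>2 * real N * P \<le> 16 * P"
    using P by (simp add: power_mult_distrib nu mult.assoc)
  then show ?thesis
    using P by simp
qed simp


section \<open>Recovering a band from powers\<close>

text \<open>Density of the orbit gives a time for each point of a finite net; the largest of these times
  serves for all targets.\<close>

lemma irrational_rotation_uniform:
  fixes \<phi> e :: real
  assumes "\<phi> \<notin> \<rat>" and "e > 0"
  obtains J :: nat where "\<And>y. \<exists>j<J. \<exists>h::int. \<bar>real j * \<phi> - of_int h - y\<bar> < e"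
proof -
  obtain M :: nat where M: "M > 0" "1 / real M < e / 2"
    using nat_approx_posE[of "e / 2"] assms(2) by (metis half_gt_zero zero_less_Suc)
  have "\<exists>k::nat. \<exists>h::int. \<bar>real k * \<phi> - of_int h - \<alpha>\<bar> < e / 2" for \<alpha>
  proof -
    obtain h k where "k > 0" "\<bar>of_int k * \<phi> - of_int h - \<alpha>\<bar> < e / 2"
      using sequence_of_fractional_parts_is_dense[OF assms(1), of "e / 2"] assms(2) by (metis half_gt_zero)
    then show ?thesis
      by (intro exI[of _ "nat k"] exI[of _ h]) auto
  qed
  then obtain K :: "real \<Rightarrow> nat" and H :: "real \<Rightarrow> int"
    where KH: "\<And>\<alpha>. \<bar>real (K \<alpha>) * \<phi> - of_int (H \<alpha>) - \<alpha>\<bar> < e / 2"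
    by metis
  define J where "J = Suc (\<Sum>i<M. K (real i / real M))"
  have "\<exists>j<J. \<exists>h::int. \<bar>real j * \<phi> - of_int h - y\<bar> < e" for y
  proof -
    define i where "i = nat \<lfloor>real M * frac y\<rfloor>"
    have i1: "real i \<le> real M * frac y" "real M * frac y < real i + 1"
      unfolding i_def by (simp_all add: frac_ge_0)
    have "real M * frac y < real M"
      using M frac_lt_1[of y] by simp
    then have iM: "i < M"
      using i1(1) by linarith
    have "real i / real M \<le> frac y" "frac y < real i / real M + 1 / real M"
      using i1 M by (simp_all add: field_simps)
    then have d: "\<bar>real i / real M - frac y\<bar> < e / 2"
      using M(2) by linarith
    let ?j = "K (real i / real M)"
    have "?j \<le> (\<Sum>i<M. K (real i / real M))"
      using iM by (intro member_le_sum) auto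
    then have "?j < J"
      by (simp add: J_def)
    moreover have "\<bar>real ?j * \<phi> - of_int (H (real i / real M) - \<lfloor>y\<rfloor>) - y\<bar> < e"
    proof -
      have tri: "\<bar>a - c\<bar> < e" if "\<bar>a - b\<bar> < e / 2" "\<bar>b - c\<bar> < e / 2" for a b c :: real
        using that by linarith
      have "real ?j * \<phi> - of_int (H (real i / real M) - \<lfloor>y\<rfloor>) - y
          = real ?j * \<phi> - of_int (H (real i / real M)) - frac y"
        by (simp add: frac_def)
      then show ?thesis
        using tri[OF KH[of "real i / real M"] d] by simp
    qed
    ultimately show ?thesis
      by blast
  qed
  then show ?thesis
    by (rule that)
qed

text \<open>The number \<open>J\<close> is uniform in the starting point \<open>N\<close>, which is what later allows \<open>N\<close> to be
  chosen after \<open>J\<close>.\<close>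

lemma sinusoid_small_on_window:
  fixes \<theta> \<alpha> \<beta> :: real
  assumes irr: "\<theta> / pi \<notin> \<rat>"
  obtains J :: nat where "\<And>N::nat. \<exists>j<J. \<bar>\<alpha> * cos (real (N + j) * \<theta>) + \<beta> * sin (real (N + j) * \<theta>)\<bar> < 2"
proof -
  define F where "F = (\<lambda>x. \<alpha> * cos x + \<beta> * sin x)"
  have cont: "continuous_on {0..pi} F"
    unfolding F_def by (intro continuous_intros)
  have "F pi = - F 0"
    by (simp add: F_def)
  then have "\<exists>x. F x = 0"
  proof (cases "F 0 \<le> 0")
    case True
    then show ?thesis
      using IVT'[OF _ _ _ cont, of 0] \<open>F pi = - F 0\<close> by auto
  next
    case False
    then show ?thesis
      using IVT2'[OF _ _ _ cont, of 0] \<open>F pi = - F 0\<close> by auto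
  qed
  then obtain x0 where x0: "F x0 = 0"
    by blast
  define B where "B = - \<alpha> * sin x0 + \<beta> * cos x0"
  \<comment> \<open>Centred at a zero, the sinusoid is a multiple of the sine.\<close>
  have FB: "F (x0 + y) = B * sin y" for y
  proof -
    have "F (x0 + y) = F x0 * cos y + B * sin y"
      by (simp add: F_def B_def cos_add sin_add algebra_simps)
    then show ?thesis
      using x0 by simp
  qed
  define e where "e = 2 / (pi * (\<bar>B\<bar> + 1))"
  have e: "e > 0"
    by (simp add: e_def add_nonneg_pos)
  obtain J where J: "\<And>y. \<exists>j<J. \<exists>h::int. \<bar>real j * (\<theta> / pi) - of_int h - y\<bar> < e"
    using irrational_rotation_uniform[OF irr e] by blast
  have "\<exists>j<J. \<bar>F (real (N + j) * \<theta>)\<bar> < 2" for N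
  proof -
    obtain j and h :: int where j: "j < J" and h: "\<bar>real j * (\<theta> / pi) - of_int h - (x0 - real N * \<theta>) / pi\<bar> < e"
      using J by blast
    define y where "y = real (N + j) * \<theta> - x0 - of_int h * pi"
    have "y = pi * (real j * (\<theta> / pi) - of_int h - (x0 - real N * \<theta>) / pi)"
      by (simp add: y_def field_simps)
    then have "\<bar>y\<bar> < pi * e"
      using h by (simp add: abs_mult)
    then have y: "\<bar>y\<bar> * (\<bar>B\<bar> + 1) < 2"
    proof -
      have "pi * e = 2 / (\<bar>B\<bar> + 1)"
        by (simp add: e_def)
      with \<open>\<bar>y\<bar> < pi * e\<close> show ?thesis
        by (simp add: pos_less_divide_eq add_nonneg_pos)
    qed
    have "\<bar>sin (y + of_int h * pi)\<bar> = \<bar>sin y\<bar>"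
      by (simp add: sin_add abs_mult cos_npi_int sin_npi_int mult.commute[of "real_of_int h"])
    then have "\<bar>F (real (N + j) * \<theta>)\<bar> = \<bar>B\<bar> * \<bar>sin y\<bar>"
      using FB[of "y + of_int h * pi"] by (simp add: y_def abs_mult)
    also have "\<dots> \<le> (\<bar>B\<bar> + 1) * \<bar>y\<bar>"
      by (intro mult_mono abs_sin_x_le_abs_x) auto
    finally show ?thesis
      using j y by (intro exI[of _ j]) (simp add: mult.commute)
  qed
  then show ?thesis
    unfolding F_def by (rule that)
qed

definition wpow :: "nat \<Rightarrow> 'a list \<Rightarrow> 'a list" where
  "wpow n w = concat (replicate n w)"

lemma wpow_0 [simp]: "wpow 0 w = []" and wpow_Suc [simp]: "wpow (Suc n) w = w @ wpow n w"
  by (simp_all add: wpow_def)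

lemma disc_power_recurrence:
  "disc v (wpow (Suc (Suc m)) w @ s) E
     = disc v w E * disc v (wpow (Suc m) w @ s) E - disc v (wpow m w @ s) E"
  unfolding disc_def wpow_Suc transfer_append matrix_mul_assoc trace_mult_square det_transfer by simp

lemma linear_recurrence_sinusoid:
  fixes t :: "nat \<Rightarrow> real"
  assumes rec: "\<And>m. t (Suc (Suc m)) = 2 * cos \<theta> * t (Suc m) - t m" and "sin \<theta> \<noteq> 0"
  shows "t m = t 0 * cos (real m * \<theta>) + (t 1 - t 0 * cos \<theta>) / sin \<theta> * sin (real m * \<theta>)"
proof -
  let ?\<beta> = "(t 1 - t 0 * cos \<theta>) / sin \<theta>"
  let ?P = "\<lambda>m. t m = t 0 * cos (real m * \<theta>) + ?\<beta> * sin (real m * \<theta>)"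
  have c: "cos (real (Suc (Suc m)) * \<theta>) = 2 * cos \<theta> * cos (real (Suc m) * \<theta>) - cos (real m * \<theta>)"
    and s: "sin (real (Suc (Suc m)) * \<theta>) = 2 * cos \<theta> * sin (real (Suc m) * \<theta>) - sin (real m * \<theta>)" for m
  proof -
    have *: "real (Suc (Suc m)) * \<theta> = real (Suc m) * \<theta> + \<theta>" "real m * \<theta> = real (Suc m) * \<theta> - \<theta>"
      by (simp_all add: algebra_simps)
    show "cos (real (Suc (Suc m)) * \<theta>) = 2 * cos \<theta> * cos (real (Suc m) * \<theta>) - cos (real m * \<theta>)"
      unfolding *(1) *(2) cos_add cos_diff by simp
    show "sin (real (Suc (Suc m)) * \<theta>) = 2 * cos \<theta> * sin (real (Suc m) * \<theta>) - sin (real m * \<theta>)"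
      unfolding *(1) *(2) sin_add sin_diff by simp
  qed
  have "?P m \<and> ?P (Suc m)"
  proof (induction m)
    case 0
    then show ?case
      using assms(2) by simp
  next
    case (Suc m)
    have "?P (Suc (Suc m))"
      unfolding rec[of m] c s using Suc by (simp only: ring_distribs) (simp add: algebra_simps)
    with Suc show ?case
      by blast
  qed
  then show ?thesis
    by blast
qed

lemma band_power_window:
  assumes E: "E \<in> band v w" and irr: "arccos (disc v w E / 2) / pi \<notin> \<rat>"
  shows "\<exists>J::nat. \<forall>N. \<exists>j<J. E \<in> band v (wpow (N + j) w @ s)"
proof -
  define \<theta> where "\<theta> = arccos (disc v w E / 2)"
  have b: "- 1 < disc v w E / 2" "disc v w E / 2 < 1"
    using E by (auto simp: band_def abs_less_iff)
  then have cos: "2 * cos \<theta> = disc v w E"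
    by (simp add: \<theta>_def)
  have "0 < \<theta>" "\<theta> < pi"
    using arccos_lt_bounded[OF b] by (auto simp: \<theta>_def)
  then have "sin \<theta> \<noteq> 0"
    using sin_gt_zero by fastforce
  let ?t = "\<lambda>m. disc v (wpow m w @ s) E"
  have t: "?t m = ?t 0 * cos (real m * \<theta>) + (?t 1 - ?t 0 * cos \<theta>) / sin \<theta> * sin (real m * \<theta>)" for m
    by (rule linear_recurrence_sinusoid) (simp_all only: disc_power_recurrence cos \<open>sin \<theta> \<noteq> 0\<close> not_False_eq_True)
  obtain J :: nat where "\<And>N. \<exists>j<J. \<bar>?t 0 * cos (real (N + j) * \<theta>)
      + (?t 1 - ?t 0 * cos \<theta>) / sin \<theta> * sin (real (N + j) * \<theta>)\<bar> < 2"
    using sinusoid_small_on_window[of \<theta> "?t 0" "(?t 1 - ?t 0 * cos \<theta>) / sin \<theta>"] irr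
    unfolding \<theta>_def by blast
  then have "\<forall>N. \<exists>j<J. \<bar>?t (N + j)\<bar> < 2"
    unfolding t[symmetric] by blast
  then show ?thesis
    unfolding band_def by (intro exI[of _ J]) simp
qed

text \<open>Each angle prescribes the value of the discriminant, which is a nonconstant polynomial.\<close>

lemma countable_rational_angles:
  assumes "w \<noteq> []"
  shows "countable {E \<in> band v w. arccos (disc v w E / 2) / pi \<in> \<rat>}"
proof (rule countable_subset)
  show "{E \<in> band v w. arccos (disc v w E / 2) / pi \<in> \<rat>} \<subseteq> (\<Union>q\<in>\<rat>. {E. disc v w E = 2 * cos (q * pi)})"
  proof
    fix E
    assume "E \<in> {E \<in> band v w. arccos (disc v w E / 2) / pi \<in> \<rat>}"
    then have E: "E \<in> band v w" and q: "arccos (disc v w E / 2) / pi \<in> \<rat>"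
      by auto
    have "- 1 \<le> disc v w E / 2" "disc v w E / 2 \<le> 1"
      using E by (auto simp: band_def abs_less_iff)
    then have "disc v w E = 2 * cos (arccos (disc v w E / 2) / pi * pi)"
      by simp
    then show "E \<in> (\<Union>q\<in>\<rat>. {E. disc v w E = 2 * cos (q * pi)})"
      using q by blast
  qed
  show "countable (\<Union>q\<in>\<rat>. {E. disc v w E = 2 * cos (q * pi)})"
    by (intro countable_UN countable_rat countable_finite finite_disc_level assms)
qed

text \<open>The energies that are bad for \<open>J\<close> and some \<open>N\<close> decrease with \<open>J\<close> to a countable set by
  \<open>band_power_window\<close>, and they are bounded, so their measures tend to 0.\<close>

lemma band_loss_small:
  fixes d :: ennreal
  assumes w: "w \<noteq> []" and "d > 0"
  shows "\<exists>J0. \<forall>J\<ge>J0. \<forall>N. emeasure lborel (band v w - (\<Union>j<J. band v (wpow (N + j) w @ s))) \<le> d"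
proof -
  define Bad where "Bad J = {E \<in> band v w. \<exists>N. \<forall>j<J. E \<notin> band v (wpow (N + j) w @ s)}" for J :: nat
  have Bad_eq: "Bad J = band v w \<inter> (\<Union>N. \<Inter>j\<in>{..<J}. - band v (wpow (N + j) w @ s))" for J
    by (auto simp: Bad_def)
  have meas: "Bad J \<in> sets borel" for J
  proof -
    have "(\<Inter>j\<in>{..<J}. - band v (wpow (N + j) w @ s)) \<in> sets borel" for N
      by (intro borel_closed closed_INT) (auto simp: closed_Compl open_band)
    then show ?thesis
      unfolding Bad_eq by (intro sets.Int sets_band sets.countable_UN) auto
  qed
  have "decseq Bad"
    unfolding decseq_def Bad_def by (auto dest: less_le_trans)
  have fin: "emeasure lborel (Bad J) \<noteq> \<infinity>" for J
  proof -
    have "bounded (Bad J)"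
      using bounded_band[OF w, of v] by (rule bounded_subset) (auto simp: Bad_def)
    then show ?thesis
      using emeasure_bounded_finite[of "Bad J"] by simp
  qed
  have "(\<Inter>J. Bad J) \<subseteq> {E \<in> band v w. arccos (disc v w E / 2) / pi \<in> \<rat>}"
    using band_power_window[of _ v w s] by (fastforce simp: Bad_def)
  then have "countable (\<Inter>J. Bad J)"
    using countable_rational_angles[OF w] countable_subset by blast
  then have "emeasure lborel (\<Inter>J. Bad J) = 0"
    by (rule emeasure_lborel_countable)
  moreover have "(\<lambda>J. emeasure lborel (Bad J)) \<longlonglongrightarrow> emeasure lborel (\<Inter>J. Bad J)"
    using meas fin \<open>decseq Bad\<close> by (intro Lim_emeasure_decseq) auto
  ultimately have "eventually (\<lambda>J. emeasure lborel (Bad J) < d) sequentially"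
    using assms(2) by (intro order_tendstoD(2)) auto
  then obtain J0 where J0: "\<And>J. J \<ge> J0 \<Longrightarrow> emeasure lborel (Bad J) < d"
    unfolding eventually_sequentially by blast
  have "emeasure lborel (band v w - (\<Union>j<J. band v (wpow (N + j) w @ s))) \<le> d" if "J \<ge> J0" for J N
  proof -
    have "emeasure lborel (band v w - (\<Union>j<J. band v (wpow (N + j) w @ s))) \<le> emeasure lborel (Bad J)"
      by (intro emeasure_mono) (auto simp: Bad_def meas)
    with J0[OF that] show ?thesis
      by simp
  qed
  then show ?thesis
    by blast
qed


section \<open>Words and windows\<close>

lemma length_wpow [simp]: "length (wpow n w) = n * length w"
  by (induction n) auto

lemma set_wpow_subset: "set (wpow n w) \<subseteq> set w"
  by (induction n) auto

lemma nth_wpow: "i < n * length w \<Longrightarrow> wpow n w ! i = w ! (i mod length w)"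
proof (induction n arbitrary: i)
  case (Suc n)
  show ?case
  proof (cases "i < length w")
    case False
    then show ?thesis
      using Suc.prems Suc.IH[of "i - length w"] by (simp add: nth_append le_mod_geq)
  qed (simp add: nth_append)
qed simp

lemma sublist_concatI: "w \<in> set ws \<Longrightarrow> sublist w (concat ws)"
  by (induction ws) (auto intro: sublist_order.order_trans[OF _ sublist_append_leftI])

lemma suffix_prefix_sublist: "suffix u x \<Longrightarrow> prefix v y \<Longrightarrow> sublist (u @ v) (x @ y)"
  by (auto simp: suffix_def prefix_def sublist_def) (metis append.assoc)

text \<open>At most \<open>b\<close> letters of \<open>u\<close> belong to the block in which it starts, and the remaining ones reach
  to the end of the next block.\<close>

lemma long_factor_contains_block:
  assumes "sublist u (concat ws)" and "\<And>x. x \<in> set ws \<Longrightarrow> length x \<le> b"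
    and "2 * b \<le> length u" and "b > 0"
  shows "\<exists>x\<in>set ws. sublist x u"
  using assms(1,2)
proof (induction ws)
  case Nil
  then show ?case
    using assms(3,4) by simp
next
  case (Cons x ws)
  consider "sublist u x" | "sublist u (concat ws)"
    | u1 u2 where "u = u1 @ u2" "suffix u1 x" "prefix u2 (concat ws)"
    using Cons.prems(1) by (auto simp: sublist_append)
  then show ?case
  proof cases
    case 1
    then show ?thesis
      using sublist_length_le[OF 1] Cons.prems(2)[of x] assms(3,4) by simp
  next
    case 2
    then show ?thesis
      using Cons by auto
  next
    case 3
    have u2: "b \<le> length u2"
      using suffix_length_le[OF 3(2)] Cons.prems(2)[of x] 3(1) assms(3) by simp
    then obtain y ws' where y: "ws = y # ws'"
      using 3(3) assms(4) by (cases ws) auto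
    have "prefix y u2"
      by (rule prefix_length_prefix[OF _ 3(3)]) (use y Cons.prems(2)[of y] u2 in auto)
    then have "sublist y u"
      unfolding 3(1) by (auto simp: prefix_def)
    then show ?thesis
      using y by auto
  qed
qed

lemma short_factor_in_two_blocks:
  assumes "sublist u (concat ws)" and "\<And>x. x \<in> set ws \<Longrightarrow> length u \<le> length x" and "u \<noteq> []"
  shows "(\<exists>x\<in>set ws. sublist u x) \<or>
    (\<exists>x\<in>set ws. \<exists>y\<in>set ws. \<exists>u1 u2. u = u1 @ u2 \<and> suffix u1 x \<and> prefix u2 y)"
  using assms(1,2)
proof (induction ws)
  case Nil
  then show ?case
    using assms(3) by simp
next
  case (Cons x ws)
  consider "sublist u x" | "sublist u (concat ws)"
    | u1 u2 where "u = u1 @ u2" "suffix u1 x" "prefix u2 (concat ws)"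
    using Cons.prems(1) by (auto simp: sublist_append)
  then show ?case
  proof cases
    case 1
    then show ?thesis
      by auto
  next
    case 2
    then show ?thesis
      using Cons.IH[OF 2] Cons.prems(2) by auto
  next
    case 3
    show ?thesis
    proof (cases "u2 = []")
      case True
      then show ?thesis
        using 3 by (auto intro: suffix_imp_sublist)
    next
      case False
      then obtain y ws' where y: "ws = y # ws'"
        using 3(3) by (cases ws) auto
      have "length u \<le> length y"
        by (rule Cons.prems(2)) (use y in auto)
      then have "length u2 \<le> length y"
        using 3(1) by simp
      then have "prefix u2 y"
        by (intro prefix_length_prefix[OF 3(3)]) (use y in auto)
      then show ?thesis
        using y 3(1,2) by auto
    qed
  qed
qed

definition window :: "(int \<Rightarrow> 'a) \<Rightarrow> int \<Rightarrow> nat \<Rightarrow> 'a list" where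
  "window \<omega> a l = map (\<lambda>i. \<omega> (a + int i)) [0..<l]"

lemma length_window [simp]: "length (window \<omega> a l) = l"
  by (simp add: window_def)

lemma nth_window [simp]: "i < l \<Longrightarrow> window \<omega> a l ! i = \<omega> (a + int i)"
  by (simp add: window_def)

lemma window_append: "window \<omega> a (l + m) = window \<omega> a l @ window \<omega> (a + int l) m"
  by (rule nth_equalityI) (auto simp: nth_append add.assoc)

lemma sublist_window:
  assumes "sublist u (window \<omega> a l)"
  obtains b where "a \<le> b" "b + int (length u) \<le> a + int l" "window \<omega> b (length u) = u"
proof -
  obtain ps ss where e: "window \<omega> a l = ps @ u @ ss"
    using assms by (auto simp: sublist_def)
  have l: "l = length ps + length u + length ss"
    using arg_cong[OF e, of length] by simp
  have "window \<omega> (a + int (length ps)) (length u) = u"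
  proof (rule nth_equalityI)
    fix i
    assume i: "i < length (window \<omega> (a + int (length ps)) (length u))"
    have "window \<omega> a l ! (length ps + i) = u ! i"
      using i unfolding e by (simp add: nth_append)
    then show "window \<omega> (a + int (length ps)) (length u) ! i = u ! i"
      using i l by (simp add: add.assoc)
  qed simp
  then show ?thesis
    by (rule that[rotated -1]) (use l in auto)
qed

lemma window_sublist_window: "sublist (window \<omega> (a + int i) m) (window \<omega> a (i + m + j))"
  by (simp add: window_append)

lemma window_translate: "window (\<lambda>m. \<omega> (m + b)) a l = window \<omega> (a + b) l"
  by (simp add: window_def algebra_simps)


section \<open>Cylinders in the full shift\<close>

lemma topspace_full_shift: "topspace (full_shift k) = {\<omega>. \<forall>i. \<omega> i \<in> {1..k}}"
  by (auto simp: full_shift_def PiE_def Pi_def)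

lemma compact_space_full_shift: "compact_space (full_shift k)"
  by (simp add: full_shift_def compact_space_product_topology compact_space_discrete_topology)

lemma openin_full_shiftI:
  assumes "finite F" and "S \<subseteq> topspace (full_shift k)"
    and det: "\<And>\<omega> \<omega>'. \<lbrakk>\<omega> \<in> S; \<omega>' \<in> topspace (full_shift k); \<And>i. i \<in> F \<Longrightarrow> \<omega>' i = \<omega> i\<rbrakk> \<Longrightarrow> \<omega>' \<in> S"
  shows "openin (full_shift k) S"
  unfolding full_shift_def openin_product_topology_alt
proof (intro ballI)
  fix \<omega>
  assume \<omega>: "\<omega> \<in> S"
  then have mem: "\<omega> i \<in> {1..k}" for i
    using assms(2) by (auto simp: topspace_full_shift)
  let ?U = "\<lambda>i. if i \<in> F then {\<omega> i} else {1..k}"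
  have "finite {i \<in> UNIV. ?U i \<noteq> topspace (discrete_topology {1..k})}"
    by (rule finite_subset[OF _ assms(1)]) auto
  moreover have "\<forall>i\<in>UNIV. openin (discrete_topology {1..k}) (?U i)"
    using mem by auto
  moreover have "\<omega> \<in> PiE UNIV ?U"
    using mem by auto
  moreover have "PiE UNIV ?U \<subseteq> S"
  proof
    fix \<omega>'
    assume *: "\<omega>' \<in> PiE UNIV ?U"
    have U: "\<omega>' i \<in> ?U i" for i
      using PiE_mem[OF * UNIV_I, of i] .
    show "\<omega>' \<in> S"
    proof (rule det[OF \<omega>])
      have "\<omega>' i \<in> {1..k}" for i
        using U[of i] mem[of i] by (simp split: if_splits)
      then show "\<omega>' \<in> topspace (full_shift k)"
        by (simp add: topspace_full_shift)
      show "\<omega>' i = \<omega> i" if "i \<in> F" for i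
        using U[of i] that by simp
    qed
  qed
  ultimately show "\<exists>U. finite {i \<in> UNIV. U i \<noteq> topspace (discrete_topology {1..k})} \<and>
      (\<forall>i\<in>UNIV. openin (discrete_topology {1..k}) (U i)) \<and> \<omega> \<in> PiE UNIV U \<and> PiE UNIV U \<subseteq> S"
    by (intro exI[of _ ?U] conjI)
qed

lemma openin_full_shiftD:
  assumes "openin (full_shift k) S" and "\<omega> \<in> S"
  obtains m :: nat where "\<And>\<omega>'. \<lbrakk>\<omega>' \<in> topspace (full_shift k); \<And>i. \<bar>i\<bar> \<le> int m \<Longrightarrow> \<omega>' i = \<omega> i\<rbrakk> \<Longrightarrow> \<omega>' \<in> S"
proof -
  obtain U where U: "finite {i. U i \<noteq> {1..k}}" "\<omega> \<in> PiE UNIV U" "PiE UNIV U \<subseteq> S"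
    using assms unfolding full_shift_def openin_product_topology_alt by fastforce
  have "finite ((\<lambda>i. nat \<bar>i\<bar>) ` {i. U i \<noteq> {1..k}})"
    using U(1) by simp
  then obtain m where m: "\<forall>x\<in>(\<lambda>i. nat \<bar>i\<bar>) ` {i. U i \<noteq> {1..k}}. x \<le> m"
    using finite_nat_set_iff_bounded_le by auto
  show ?thesis
  proof (rule that[of m])
    fix \<omega>'
    assume top: "\<omega>' \<in> topspace (full_shift k)" and eq: "\<And>i. \<bar>i\<bar> \<le> int m \<Longrightarrow> \<omega>' i = \<omega> i"
    have "\<omega>' i \<in> U i" for i
    proof (cases "U i = {1..k}")
      case True
      then show ?thesis
        using top by (simp add: topspace_full_shift)
    next
      case False
      then have "\<bar>i\<bar> \<le> int m"
        using m by force
      then show ?thesis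
        using eq U(2) by auto
    qed
    then show "\<omega>' \<in> S"
      using U(3) by auto
  qed
qed


section \<open>Towers of words\<close>

definition next_level :: "nat \<Rightarrow> nat \<Rightarrow> 'a list list \<Rightarrow> 'a list list" where
  "next_level N J W = concat (map (\<lambda>w. map (\<lambda>j. wpow (N + j) w @ concat W) [0..<J]) W)"

lemma set_next_level: "set (next_level N J W) = {wpow (N + j) w @ concat W | w j. w \<in> set W \<and> j < J}"
  by (fastforce simp: next_level_def)

lemma length_next_level: "length (next_level N J W) = length W * J"
proof -
  have "length (concat (map (\<lambda>w. map (\<lambda>j. wpow (N + j) w @ X) [0..<J]) V)) = length V * J"
    for X and V :: "'a list list"
    by (induction V) auto
  then show ?thesis
    by (simp add: next_level_def)
qed

lemma length_concat_le:
  assumes "\<And>w. w \<in> set W \<Longrightarrow> length w \<le> b"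
  shows "length (concat W) \<le> length W * b"
  using assms by (induction W) (auto intro: add_mono)

text \<open>The sequence \<open>... w w s w' w' ...\<close> with \<open>s\<close> starting at position 0.\<close>

definition glue :: "'a list \<Rightarrow> 'a list \<Rightarrow> 'a list \<Rightarrow> int \<Rightarrow> 'a" where
  "glue w s w' i = (if i < 0 then w ! nat (i mod int (length w))
     else if i < int (length s) then s ! nat i
     else w' ! nat ((i - int (length s)) mod int (length w')))"

lemma window_glue:
  assumes "w \<noteq> []" "w' \<noteq> []"
  shows "window (glue w s w') (- int (c * length w)) (c * length w + (length s + c' * length w'))
     = wpow c w @ s @ wpow c' w'"
proof -
  have 1: "window (glue w s w') (- int (c * length w)) (c * length w) = wpow c w"
  proof (rule nth_equalityI)
    fix i
    assume "i < length (window (glue w s w') (- int (c * length w)) (c * length w))"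
    then have i: "i < c * length w"
      by simp
    have "(- int (c * length w) + int i) mod int (length w) = int (i mod length w)"
      by (simp add: zmod_int mod_add_eq flip: mult_minus_left)
    moreover have "- int (c * length w) + int i < 0"
      using i by linarith
    ultimately show "window (glue w s w') (- int (c * length w)) (c * length w) ! i = wpow c w ! i"
      using i by (simp only: nth_window glue_def nth_wpow if_True nat_int)
  qed simp
  have 2: "window (glue w s w') 0 (length s) = s"
    by (rule nth_equalityI) (auto simp: glue_def)
  have 3: "window (glue w s w') (int (length s)) (c' * length w') = wpow c' w'"
    by (rule nth_equalityI) (auto simp: glue_def nth_wpow nat_mod_distrib)
  show ?thesis
    unfolding window_append 1 using 2 3 by simp
qed

text \<open>The number of starting positions must not grow with the exponents \<open>c\<close> and \<open>c'\<close>. A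
  factor that avoids \<open>s\<close> lies in a purely periodic stretch, and can be moved by multiples of the
  period into the left half of a glued sequence, next to \<open>s\<close>.\<close>

lemma factor_of_glue:
  assumes w: "w \<in> A" "w' \<in> A" and ne: "\<And>x. x \<in> A \<Longrightarrow> x \<noteq> []"
    and len: "\<And>x. x \<in> A \<Longrightarrow> length x \<le> length s"
    and sub: "sublist u (wpow c w @ s @ wpow c' w')"
  shows "\<exists>x\<in>A. \<exists>y\<in>A. \<exists>a\<in>{- int (length u + length s)..<int (length s)}.
    u = window (glue x s y) a (length u)"
proof -
  let ?l = "length u" and ?S = "length s"
  have "sublist u (window (glue w s w') (- int (c * length w)) (c * length w + (length s + c' * length w')))"
    unfolding window_glue[OF ne[OF w(1)] ne[OF w(2)]] by (rule sub)
  then obtain b where b: "window (glue w s w') b ?l = u"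
    by (rule sublist_window)
  \<comment> \<open>A factor to the left of \<open>s\<close> can be moved by the period until it is close to \<open>s\<close>.\<close>
  have move: "\<exists>a\<in>{- int (?l + ?S)..<int ?S}. u = window (glue x s x) a ?l"
    if x: "x \<in> A" and eq: "\<And>i. i < ?l \<Longrightarrow> u ! i = x ! nat ((d + int i) mod int (length x))" for x d
  proof -
    let ?p = "int (length x)"
    have p: "?p > 0"
      using ne[OF x] by simp
    define a where "a = - int ?l - ((- int ?l - d) mod ?p)"
    have r: "0 \<le> (- int ?l - d) mod ?p" "(- int ?l - d) mod ?p < ?p"
      using p by auto
    have m: "(a + int i) mod ?p = (d + int i) mod ?p" for i
    proof -
      have "(a + int i) mod ?p = (- int ?l + int i - (- int ?l - d) mod ?p) mod ?p"
        by (simp add: a_def algebra_simps)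
      also have "\<dots> = (- int ?l + int i - (- int ?l - d)) mod ?p"
        by (simp only: mod_diff_right_eq)
      finally show ?thesis
        by (simp add: algebra_simps)
    qed
    have "u = window (glue x s x) a ?l"
    proof (rule nth_equalityI)
      fix i
      assume i: "i < ?l"
      have "a + int i < 0"
        using r(1) i unfolding a_def by linarith
      then show "u ! i = window (glue x s x) a ?l ! i"
        using i eq[OF i] by (simp add: glue_def m)
    qed simp
    moreover have "a \<in> {- int (?l + ?S)..<int ?S}"
      using r len[OF x] unfolding a_def by auto
    ultimately show ?thesis
      by blast
  qed
  have un: "u ! i = glue w s w' (b + int i)" if "i < ?l" for i
    using arg_cong[OF b, of "\<lambda>x. x ! i"] that by simp
  consider "b + int ?l \<le> 0" | "b \<ge> int ?S" | "- int ?l < b" "b < int ?S"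
    by linarith
  then show ?thesis
  proof cases
    case 1
    have "\<exists>a\<in>{- int (?l + ?S)..<int ?S}. u = window (glue w s w) a ?l"
      by (rule move[OF w(1), of b]) (use un 1 in \<open>auto simp: glue_def\<close>)
    then show ?thesis
      using w(1) by blast
  next
    case 2
    have "\<exists>a\<in>{- int (?l + ?S)..<int ?S}. u = window (glue w' s w') a ?l"
      by (rule move[OF w(2), of "b - int ?S"]) (use un 2 in \<open>auto simp: glue_def algebra_simps\<close>)
    then show ?thesis
      using w(2) by blast
  next
    case 3
    then have "b \<in> {- int (?l + ?S)..<int ?S}"
      by auto
    then show ?thesis
      using w b by (intro bexI[of _ w] bexI[of _ w'] bexI[of _ b]) simp_all
  qed
qed

text \<open>Adding the concatenation of the previous level to each word makes all words of a level occur
  everywhere; \<open>J n \<ge> 2\<close> serves aperiodicity, and \<open>N n > n\<close> makes the powers unbounded.\<close>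

locale tower =
  fixes W :: "nat \<Rightarrow> nat list list" and N J :: "nat \<Rightarrow> nat"
  assumes W_0: "W 0 = [[1], [2]]"
    and W_Suc: "W (Suc n) = next_level (N n) (J n) (W n)"
    and J_ge: "J n \<ge> 2" and N_gt: "N n > n"
begin

definition lang :: "nat list set" where
  "lang = {u. \<exists>n. \<exists>w\<in>set (W n). sublist u w}"

definition Omega :: "(int \<Rightarrow> nat) set" where
  "Omega = {\<omega>. \<forall>a l. window \<omega> a l \<in> lang}"

lemma W_Suc_cases:
  assumes "x \<in> set (W (Suc n))"
  obtains w j where "w \<in> set (W n)" "j < J n" "x = wpow (N n + j) w @ concat (W n)"
  using assms by (auto simp: W_Suc set_next_level)

lemma W_SucI: "w \<in> set (W n) \<Longrightarrow> j < J n \<Longrightarrow> wpow (N n + j) w @ concat (W n) \<in> set (W (Suc n))"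
  by (auto simp: W_Suc set_next_level)

lemma W_words: "w \<in> set (W n) \<Longrightarrow> w \<noteq> [] \<and> set w \<subseteq> {1, 2}"
proof (induction n arbitrary: w)
  case 0
  then show ?case
    by (auto simp: W_0)
next
  case (Suc n)
  obtain x j where x: "x \<in> set (W n)" "w = wpow (N n + j) x @ concat (W n)"
    using Suc.prems by (rule W_Suc_cases)
  have "concat (W n) \<noteq> []"
    using x(1) Suc.IH[OF x(1)] by auto
  then show ?case
    using Suc.IH x set_wpow_subset[of "N n + j" x] by fastforce
qed

lemma W_nonempty: "W n \<noteq> []"
proof (induction n)
  case (Suc n)
  then have "length (W (Suc n)) > 0"
    using J_ge[of n] by (simp add: W_Suc length_next_level)
  then show ?case
    by simp
qed (simp add: W_0)

lemma W_sublist_W_Suc: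
  assumes "w \<in> set (W n)" "x \<in> set (W (Suc n))"
  shows "sublist w x"
  using assms(2) sublist_concatI[OF assms(1)]
  by (elim W_Suc_cases) (auto intro: sublist_order.order_trans[OF _ sublist_append_leftI])

lemma W_decompose: "x \<in> set (W (n + m)) \<Longrightarrow> \<exists>ws. set ws \<subseteq> set (W n) \<and> x = concat ws"
proof (induction m arbitrary: x)
  case 0
  then show ?case
    by (intro exI[of _ "[x]"]) auto
next
  case (Suc m)
  have *: "\<exists>ws. set ws \<subseteq> set (W n) \<and> concat ys = concat ws" if "set ys \<subseteq> set (W (n + m))" for ys
    using that
  proof (induction ys)
    case (Cons y ys)
    obtain ws where ws: "set ws \<subseteq> set (W n)" "concat ys = concat ws"
      using Cons by auto
    obtain vs where vs: "set vs \<subseteq> set (W n)" "y = concat vs"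
      using Suc.IH[of y] Cons.prems by auto
    show ?case
      by (rule exI[of _ "vs @ ws"]) (use ws vs in auto)
  qed (auto intro: exI[of _ "[]"])
  have "x \<in> set (W (Suc (n + m)))"
    using Suc.prems by simp
  then obtain w j where w: "w \<in> set (W (n + m))" "x = wpow (N (n + m) + j) w @ concat (W (n + m))"
    by (rule W_Suc_cases)
  then have "x = concat (replicate (N (n + m) + j) w @ W (n + m))"
    by (simp add: wpow_def)
  moreover have "set (replicate (N (n + m) + j) w @ W (n + m)) \<subseteq> set (W (n + m))"
    using w(1) by auto
  ultimately show ?case
    using * by metis
qed

lemma lang_sublist: "v \<in> lang \<Longrightarrow> sublist u v \<Longrightarrow> u \<in> lang"
  unfolding lang_def using sublist_order.order_trans by blast

lemma W_subset_lang: "w \<in> set (W n) \<Longrightarrow> w \<in> lang"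
  unfolding lang_def by blast

lemma lang_at_level:
  assumes "u \<in> lang"
  shows "\<exists>ws. set ws \<subseteq> set (W n) \<and> sublist u (concat ws)"
proof -
  obtain m w where w: "w \<in> set (W m)" "sublist u w"
    using assms by (auto simp: lang_def)
  have "\<exists>x\<in>set (W (m + d)). sublist u x" for d
  proof (induction d)
    case 0
    then show ?case
      using w by auto
  next
    case (Suc d)
    then obtain x where x: "x \<in> set (W (m + d))" "sublist u x"
      by auto
    obtain y where y: "y \<in> set (W (Suc (m + d)))"
      using W_nonempty[of "Suc (m + d)"] by (meson list.set_sel(1))
    show ?case
      using y sublist_order.order_trans[OF x(2) W_sublist_W_Suc[OF x(1) y]] by auto
  qed
  then obtain x where x: "x \<in> set (W (m + n))" "sublist u x"
    by blast
  then show ?thesis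
    using W_decompose[of x n m] by (auto simp: add.commute)
qed

lemma Omega_windowD: "\<omega> \<in> Omega \<Longrightarrow> window \<omega> a l \<in> lang"
  by (simp add: Omega_def)

text \<open>A long window is a factor of a concatenation of words one level above that of \<open>u\<close>, so it
  contains one of these words, and each of them contains \<open>u\<close>.\<close>

lemma lang_occurs:
  assumes u: "u \<in> lang" and \<omega>: "\<omega> \<in> Omega"
  obtains a where "window \<omega> a (length u) = u"
proof -
  obtain m w where w: "w \<in> set (W m)" "sublist u w"
    using u by (auto simp: lang_def)
  define b where "b = Suc (\<Sum>x\<leftarrow>W (Suc m). length x)"
  have b: "length x \<le> b" if "x \<in> set (W (Suc m))" for x
    using member_le_sum_list[of "length x" "map length (W (Suc m))"] that by (simp add: b_def)
  have "window \<omega> 0 (2 * b) \<in> lang"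
    by (rule Omega_windowD[OF \<omega>])
  then obtain ws where ws: "set ws \<subseteq> set (W (Suc m))" "sublist (window \<omega> 0 (2 * b)) (concat ws)"
    using lang_at_level by blast
  then obtain x where x: "x \<in> set ws" "sublist x (window \<omega> 0 (2 * b))"
    using long_factor_contains_block[OF ws(2), of b] b by (auto simp: b_def)
  have "sublist u (window \<omega> 0 (2 * b))"
    using w(2) W_sublist_W_Suc[OF w(1)] x ws(1) by (meson sublist_order.order_trans subsetD)
  then show ?thesis
    using sublist_window that by metis
qed

lemma lang_letters: "u \<in> lang \<Longrightarrow> set u \<subseteq> {1, 2}"
  using W_words set_mono_sublist unfolding lang_def by fast

lemma lang_long_words: "\<exists>u\<in>lang. length u = l"
proof -
  obtain w where w: "w \<in> set (W l)"
    using W_nonempty[of l] by (meson list.set_sel(1))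
  let ?x = "wpow (N l + 0) w @ concat (W l)"
  have "?x \<in> lang"
    using J_ge[of l] by (intro W_subset_lang[OF W_SucI[OF w]]) simp
  then have "take l ?x \<in> lang"
    by (rule lang_sublist) (rule sublist_take)
  moreover have "length w \<ge> 1"
    using W_words[OF w] by (simp add: Suc_leI)
  then have "l \<le> N l * length w"
    using N_gt[of l] by (metis less_imp_le_nat mult.right_neutral mult_le_mono)
  then have "length (take l ?x) = l"
    by simp
  ultimately show ?thesis
    by blast
qed

lemma Omega_letters: "\<omega> \<in> Omega \<Longrightarrow> \<omega> i \<in> {1, 2}"
  using lang_letters[OF Omega_windowD, of \<omega> i 1] by (simp add: window_def)

lemma Omega_translate: "(\<lambda>m. \<omega> (m + b)) \<in> Omega \<longleftrightarrow> \<omega> \<in> Omega"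
proof -
  have "\<omega> \<in> Omega \<Longrightarrow> (\<lambda>m. \<omega> (m + b)) \<in> Omega" for \<omega> and b :: int
    by (simp add: Omega_def window_translate)
  from this[of \<omega> b] this[of "\<lambda>m. \<omega> (m + b)" "- b"] show ?thesis
    by auto
qed

lemma Omega_locally_equal:
  assumes "\<omega> \<in> Omega" "\<omega>' \<in> Omega"
  shows "\<exists>a. \<forall>i. \<bar>i\<bar> \<le> int m \<longrightarrow> \<omega>' i = \<omega> (i + a)"
proof -
  let ?l = "2 * m + 1"
  obtain b where b: "window \<omega> b ?l = window \<omega>' (- int m) ?l"
    using lang_occurs[OF Omega_windowD[OF assms(2)] assms(1)] length_window by metis
  have "\<omega>' i = \<omega> (i + (b + int m))" if i: "\<bar>i\<bar> \<le> int m" for i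
  proof -
    have n: "nat (i + int m) < ?l"
      using i by linarith
    have "window \<omega> b ?l ! nat (i + int m) = window \<omega>' (- int m) ?l ! nat (i + int m)"
      by (simp only: b)
    moreover have "int (nat (i + int m)) = i + int m"
      using i by simp
    ultimately show ?thesis
      unfolding nth_window[OF n] by (simp add: algebra_simps)
  qed
  then show ?thesis
    by blast
qed

lemma Omega_subset_topspace: "k \<ge> 2 \<Longrightarrow> Omega \<subseteq> topspace (full_shift k)"
proof
  fix \<omega>
  assume "k \<ge> 2" "\<omega> \<in> Omega"
  then have "\<omega> i \<in> {1..k}" for i
    using Omega_letters[of \<omega> i] by auto
  then show "\<omega> \<in> topspace (full_shift k)"
    by (simp add: topspace_full_shift)
qed

text \<open>The set is the intersection of the decreasing closed sets given by the windows around 0, each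
  of which is nonempty because the language contains words of all lengths.\<close>

lemma compactin_Omega_and_nonempty:
  assumes "k \<ge> 2"
  shows "compactin (full_shift k) Omega" and "Omega \<noteq> {}"
proof -
  define C where "C m = {\<omega> \<in> topspace (full_shift k). window \<omega> (- int m) (2 * m + 1) \<in> lang}" for m :: nat
  have closed: "closedin (full_shift k) (C m)" for m
    unfolding closedin_def
  proof
    show "C m \<subseteq> topspace (full_shift k)"
      by (auto simp: C_def)
    show "openin (full_shift k) (topspace (full_shift k) - C m)"
    proof (rule openin_full_shiftI[of "{- int m..int m}"])
      fix \<omega> \<omega>'
      assume a: "\<omega> \<in> topspace (full_shift k) - C m" "\<omega>' \<in> topspace (full_shift k)"
        and eq: "\<And>i. i \<in> {- int m..int m} \<Longrightarrow> \<omega>' i = \<omega> i"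
      have "window \<omega>' (- int m) (2 * m + 1) = window \<omega> (- int m) (2 * m + 1)"
        by (rule nth_equalityI) (auto intro!: eq)
      then show "\<omega>' \<in> topspace (full_shift k) - C m"
        using a by (simp add: C_def)
    qed auto
  qed
  have Omega_eq: "Omega = (\<Inter>m. C m)"
  proof
    show "Omega \<subseteq> (\<Inter>m. C m)"
      using Omega_subset_topspace[OF assms] by (auto simp: C_def Omega_windowD)
    show "(\<Inter>m. C m) \<subseteq> Omega"
    proof
      fix \<omega>
      assume \<omega>: "\<omega> \<in> (\<Inter>m. C m)"
      have "window \<omega> a l \<in> lang" for a l
      proof -
        define m where "m = nat \<bar>a\<bar> + l"
        define i where "i = nat (a + int m)"
        define j where "j = 2 * m + 1 - (i + l)"
        have i: "a = - int m + int i" "i + l \<le> 2 * m + 1"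
        proof -
          have "int m = \<bar>a\<bar> + int l"
            by (simp add: m_def)
          moreover from this have "int i = a + int m"
            by (simp add: i_def)
          ultimately show "a = - int m + int i" "i + l \<le> 2 * m + 1"
            by linarith+
        qed
        have "window \<omega> (- int m) (i + l + j) \<in> lang"
          using \<omega> i(2) by (auto simp: C_def j_def)
        then show ?thesis
          unfolding i(1) by (rule lang_sublist[OF _ window_sublist_window])
      qed
      then show "\<omega> \<in> Omega"
        by (simp add: Omega_def)
    qed
  qed
  have "closedin (full_shift k) Omega"
    unfolding Omega_eq by (intro closedin_Inter) (auto simp: closed)
  then show "compactin (full_shift k) Omega"
    by (rule closedin_compact_space[OF compact_space_full_shift])
  have ne: "C m \<noteq> {}" for m
  proof -
    obtain u where u: "u \<in> lang" "length u = 2 * m + 1"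
      using lang_long_words by blast
    let ?\<omega> = "\<lambda>i. if 0 \<le> i + int m \<and> i + int m < int (2 * m + 1) then u ! nat (i + int m) else 1"
    have "window ?\<omega> (- int m) (2 * m + 1) = u"
      by (rule nth_equalityI) (use u in auto)
    moreover have "?\<omega> i \<in> {1..k}" for i
    proof (cases "0 \<le> i + int m \<and> i + int m < int (2 * m + 1)")
      case True
      then have "u ! nat (i + int m) \<in> set u"
        using u(2) by (intro nth_mem) linarith
      then show ?thesis
        using lang_letters[OF u(1)] assms True by auto
    qed (use assms in auto)
    ultimately have "?\<omega> \<in> C m"
      using u(1) by (simp only: C_def topspace_full_shift mem_Collect_eq) blast
    then show ?thesis
      by blast
  qed
  have dec: "decseq C"
  proof (rule decseq_SucI)
    fix m
    have "window \<omega> (- int m) (2 * m + 1) \<in> lang" if "window \<omega> (- int (Suc m)) (2 * Suc m + 1) \<in> lang" for \<omega>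
      using lang_sublist[OF that, of "window \<omega> (- int m) (2 * m + 1)"]
        window_sublist_window[of \<omega> "- int (Suc m)" 1 "2 * m + 1" 1] by simp
    then show "C (Suc m) \<subseteq> C m"
      unfolding C_def by blast
  qed
  show "Omega \<noteq> {}"
    unfolding Omega_eq by (rule compact_space_imp_nest[OF compact_space_full_shift closed ne dec])
qed

lemma minimal_Omega:
  assumes "k \<ge> 2"
  shows "minimal_subshift k Omega"
  unfolding minimal_subshift_def
proof (intro conjI ballI)
  have "shift ` Omega = Omega"
  proof
    show "shift ` Omega \<subseteq> Omega"
      using Omega_translate by (auto simp: shift_def)
    show "Omega \<subseteq> shift ` Omega"
    proof
      fix \<omega>
      assume "\<omega> \<in> Omega"
      then have "(\<lambda>m. \<omega> (m + (-1))) \<in> Omega"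
        using Omega_translate by blast
      moreover have "\<omega> = shift (\<lambda>m. \<omega> (m + (-1)))"
        by (simp add: shift_def)
      ultimately show "\<omega> \<in> shift ` Omega"
        by blast
    qed
  qed
  then show "subshift k Omega"
    using compactin_Omega_and_nonempty[OF assms] by (simp add: subshift_def)
  fix \<omega>
  assume \<omega>: "\<omega> \<in> Omega"
  have top: "topspace (subtopology (full_shift k) Omega) = Omega"
    using Omega_subset_topspace[OF assms] by (auto simp: topspace_subtopology)
  show "subtopology (full_shift k) Omega closure_of shift_orbit \<omega> = Omega"
  proof
    show "subtopology (full_shift k) Omega closure_of shift_orbit \<omega> \<subseteq> Omega"
      using closure_of_subset_topspace top by metis
    show "Omega \<subseteq> subtopology (full_shift k) Omega closure_of shift_orbit \<omega>"
    proof
      fix \<omega>'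
      assume \<omega>': "\<omega>' \<in> Omega"
      have "\<exists>y. y \<in> shift_orbit \<omega> \<and> y \<in> T"
        if T: "\<omega>' \<in> T" "openin (subtopology (full_shift k) Omega) T" for T
      proof -
        obtain U where U: "openin (full_shift k) U" "T = U \<inter> Omega"
          using T(2) by (auto simp: openin_subtopology)
        obtain m where m: "\<And>y. \<lbrakk>y \<in> topspace (full_shift k); \<And>i. \<bar>i\<bar> \<le> int m \<Longrightarrow> y i = \<omega>' i\<rbrakk> \<Longrightarrow> y \<in> U"
          using openin_full_shiftD[OF U(1), of \<omega>'] T(1) U(2) by blast
        obtain a where a: "\<And>i. \<bar>i\<bar> \<le> int m \<Longrightarrow> \<omega>' i = \<omega> (i + a)"
          using Omega_locally_equal[OF \<omega> \<omega>'] by blast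
        let ?y = "\<lambda>i. \<omega> (i + a)"
        have "?y \<in> Omega"
          using \<omega> by (simp add: Omega_translate)
        moreover from this have "?y \<in> U"
          using Omega_subset_topspace[OF assms] a by (intro m) auto
        ultimately show ?thesis
          using U(2) by (auto simp: shift_orbit_def)
      qed
      then show "\<omega>' \<in> subtopology (full_shift k) Omega closure_of shift_orbit \<omega>"
        using \<omega>' unfolding in_closure_of top by blast
    qed
  qed
qed

lemma power_occurs:
  assumes w: "w \<in> set (W n)" and \<omega>: "\<omega> \<in> Omega"
  obtains a where "\<And>i. i < N n * length w \<Longrightarrow> \<omega> (a + int i) = w ! (i mod length w)"
proof -
  have "wpow (N n + 0) w @ concat (W n) \<in> lang"
    using J_ge[of n] by (intro W_subset_lang[OF W_SucI[OF w]]) simp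
  then have "wpow (N n) w \<in> lang"
    by (rule lang_sublist) simp
  then obtain a where a: "window \<omega> a (length (wpow (N n) w)) = wpow (N n) w"
    using lang_occurs[OF _ \<omega>] by blast
  show ?thesis
  proof (rule that[of a])
    fix i
    assume "i < N n * length w"
    then show "\<omega> (a + int i) = w ! (i mod length w)"
      using arg_cong[OF a, of "\<lambda>x. x ! i"] by (simp add: nth_wpow)
  qed
qed

text \<open>For a sequence of period \<open>P\<close>, every \<open>w\<close> of level \<open>P\<close> gives a period \<open>length w\<close>, since
  \<open>w^(P + 1)\<close> occurs and repeats after \<open>length w\<close> places on a stretch of length \<open>P\<close>. These
  periods descend to level 0.\<close>

lemma aperiodic_Omega: "aperiodic Omega"
  unfolding aperiodic_def
proof
  assume "\<exists>\<omega>\<in>Omega. \<exists>n>0. (shift ^^ n) \<omega> = \<omega>"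
  then obtain \<omega> P where \<omega>: "\<omega> \<in> Omega" and P: "P > 0" "(shift ^^ P) \<omega> = \<omega>"
    by blast
  have sh: "(shift ^^ n) \<omega> = (\<lambda>m. \<omega> (m + int n))" for n
    by (induction n) (auto simp: shift_def algebra_simps)
  have per: "\<omega> (m + int P) = \<omega> m" for m
    using fun_cong[OF P(2), of m] by (simp add: sh)
  have perq: "\<omega> (m + q * int P) = \<omega> m" for m q
  proof -
    have nat: "\<omega> (m + int q * int P) = \<omega> m" for m and q :: nat
    proof (induction q)
      case (Suc q)
      then show ?case
        using per[of "m + int q * int P"] by (simp add: algebra_simps)
    qed simp
    show ?thesis
      using nat[of m "nat q"] nat[of "m + q * int P" "nat (- q)"] by (cases "q \<ge> 0") auto
  qed
  have top: "\<omega> (m + int (length w)) = \<omega> m" if w: "w \<in> set (W P)" for w m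
  proof -
    obtain a where a: "\<And>i. i < N P * length w \<Longrightarrow> \<omega> (a + int i) = w ! (i mod length w)"
      using power_occurs[OF w \<omega>] by blast
    define t where "t = nat ((m - a) mod int P)"
    have t: "t < P" "m = a + int t + ((m - a) div int P) * int P"
      using P(1) by (simp_all add: t_def nat_less_iff)
    have "length w \<ge> 1"
      using W_words[OF w] by (simp add: Suc_leI)
    then have "t + length w < Suc P * length w"
    proof -
      have "P * 1 \<le> P * length w"
        using \<open>length w \<ge> 1\<close> by (intro mult_le_mono) auto
      then show ?thesis
        using t(1) unfolding mult_Suc by linarith
    qed
    also have "\<dots> \<le> N P * length w"
      using N_gt[of P] by (intro mult_le_mono) auto
    finally have "\<omega> (a + int (t + length w)) = \<omega> (a + int t)"
      by (subst (1 2) a) auto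
    moreover have "m + int (length w) = a + int (t + length w) + (m - a) div int P * int P"
      using t(2) by linarith
    then have "\<omega> (m + int (length w)) = \<omega> (a + int (t + length w))"
      using perq by metis
    moreover have "\<omega> m = \<omega> (a + int t)"
      using t(2) perq by metis
    ultimately show ?thesis
      by simp
  qed
  \<comment> \<open>Exponents \<open>N n\<close> and \<open>N n + 1\<close> both occur, so periods descend from level to level.\<close>
  have down: "\<forall>w\<in>set (W (P - d)). \<forall>m. \<omega> (m + int (length w)) = \<omega> m" if "d \<le> P" for d
    using that
  proof (induction d)
    case 0
    then show ?case
      using top by simp
  next
    case (Suc d)
    define n where "n = P - Suc d"
    have n: "P - d = Suc n"
      using Suc.prems by (simp add: n_def)
    have IH: "\<omega> (m + int (length x)) = \<omega> m" if "x \<in> set (W (P - d))" for x m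
      using Suc.IH Suc.prems that by simp
    have "\<omega> (m + int (length w)) = \<omega> m" if w: "w \<in> set (W n)" for w m
    proof -
      have x: "wpow (N n + 0) w @ concat (W n) \<in> set (W (P - d))"
        "wpow (N n + 1) w @ concat (W n) \<in> set (W (P - d))"
        unfolding n using J_ge[of n] w by (intro W_SucI; simp)+
      let ?x = "length (wpow (N n + 0) w @ concat (W n))"
      have "\<omega> (m + int (length w)) = \<omega> (m + int (length w) + int ?x)"
        by (rule IH[OF x(1), symmetric])
      also have "\<dots> = \<omega> (m + int (length (wpow (N n + 1) w @ concat (W n))))"
        by (simp add: algebra_simps)
      also have "\<dots> = \<omega> m"
        by (rule IH[OF x(2)])
      finally show ?thesis .
    qed
    then show ?case
      by (simp add: n_def)
  qed
  have one: "\<omega> (m + 1) = \<omega> m" for m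
    using down[of P] by (simp add: W_0)
  have const: "\<omega> m = \<omega> 0" for m
  proof -
    have "\<omega> (a + int n) = \<omega> a" for a and n :: nat
    proof (induction n)
      case (Suc n)
      then show ?case
        using one[of "a + int n"] by (simp add: algebra_simps)
    qed simp
    from this[of 0 "nat m"] this[of m "nat (- m)"] show ?thesis
      by (cases "m \<ge> 0") auto
  qed
  have "[x] \<in> lang \<Longrightarrow> \<exists>a. \<omega> a = x" for x
    using lang_occurs[OF _ \<omega>, of "[x]"] by (auto simp: window_def)
  moreover have "[1] \<in> lang" "[2] \<in> lang"
    by (auto intro: W_subset_lang[of _ 0] simp: W_0)
  ultimately obtain a b where "\<omega> a = 1" "\<omega> b = 2"
    by blast
  then show False
    using const[of a] const[of b] by simp
qed

lemma lang_words_glue: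
  assumes u: "u \<in> lang" and l: "length u \<le> N n" "u \<noteq> []"
  shows "\<exists>x\<in>set (W n). \<exists>y\<in>set (W n).
    \<exists>a\<in>{- int (length u + length (concat (W n)))..<int (length (concat (W n)))}.
      u = window (glue x (concat (W n)) y) a (length u)"
proof -
  let ?s = "concat (W n)"
  obtain ws where ws: "set ws \<subseteq> set (W (Suc n))" "sublist u (concat ws)"
    using lang_at_level[OF u] by blast
  have long: "length u \<le> length (wpow (N n + j) w)" if "w \<in> set (W n)" for w j
  proof -
    have "length w \<ge> 1"
      using W_words[OF that] by (simp add: Suc_leI)
    then have "N n * 1 \<le> (N n + j) * length w"
      by (intro mult_le_mono) auto
    then show ?thesis
      using l by simp
  qed
  have "length u \<le> length x" if "x \<in> set ws" for x
  proof -
    have "x \<in> set (W (Suc n))"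
      using ws(1) that by blast
    then obtain w j where "w \<in> set (W n)" "x = wpow (N n + j) w @ ?s"
      by (rule W_Suc_cases)
    then show ?thesis
      using long[of w j] by simp
  qed
  then consider x where "x \<in> set (W (Suc n))" "sublist u x"
    | x y u1 u2 where "x \<in> set (W (Suc n))" "y \<in> set (W (Suc n))" "u = u1 @ u2" "suffix u1 x" "prefix u2 y"
    using short_factor_in_two_blocks[OF ws(2) _ l(2)] ws(1) by blast
  then have "\<exists>w\<in>set (W n). \<exists>w'\<in>set (W n). \<exists>c c'. sublist u (wpow c w @ ?s @ wpow c' w')"
  proof cases
    case 1
    obtain w j where "w \<in> set (W n)" "x = wpow (N n + j) w @ ?s"
      using 1(1) by (rule W_Suc_cases)
    then have "sublist u (wpow (N n + j) w @ ?s @ wpow 0 w)"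
      using 1(2) by simp
    then show ?thesis
      using \<open>w \<in> set (W n)\<close> by blast
  next
    case 2
    obtain w j where w: "w \<in> set (W n)" "x = wpow (N n + j) w @ ?s"
      using 2(1) by (rule W_Suc_cases)
    obtain w' j' where w': "w' \<in> set (W n)" "y = wpow (N n + j') w' @ ?s"
      using 2(2) by (rule W_Suc_cases)
    have "prefix u2 (wpow (N n + j') w')"
      by (rule prefix_length_prefix[OF 2(5)]) (use w' long[OF w'(1), of j'] 2(3) in auto)
    then have "sublist u (x @ wpow (N n + j') w')"
      unfolding 2(3) by (rule suffix_prefix_sublist[OF 2(4)])
    then have "sublist u (wpow (N n + j) w @ ?s @ wpow (N n + j') w')"
      by (simp add: w(2))
    then show ?thesis
      using w(1) w'(1) by blast
  qed
  then obtain w w' c c' where w: "w \<in> set (W n)" "w' \<in> set (W n)"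
    and sub: "sublist u (wpow c w @ ?s @ wpow c' w')"
    by blast
  have len: "length x \<le> length ?s" if "x \<in> set (W n)" for x
    using sublist_length_le[OF sublist_concatI[OF that]] .
  have ne: "x \<noteq> []" if "x \<in> set (W n)" for x
    using W_words[OF that] by blast
  show ?thesis
    by (rule factor_of_glue[where A = "set (W n)", OF w ne len sub])
qed

lemma complexity_Omega_le:
  assumes "1 \<le> l" "l \<le> N n"
  shows "complexity Omega l \<le> (length (W n))\<^sup>2 * (l + 2 * length (concat (W n)))"
proof -
  let ?s = "concat (W n)"
  let ?I = "{- int (l + length ?s)..<int (length ?s)}"
  let ?f = "\<lambda>(x, y, a). window (glue x ?s y) a l"
  have "(\<lambda>\<omega>. map (\<lambda>i. \<omega> (int i)) [0..<l]) ` Omega \<subseteq> ?f ` (set (W n) \<times> set (W n) \<times> ?I)"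
  proof
    fix u
    assume "u \<in> (\<lambda>\<omega>. map (\<lambda>i. \<omega> (int i)) [0..<l]) ` Omega"
    then obtain \<omega> where \<omega>: "\<omega> \<in> Omega" "u = window \<omega> 0 l"
      by (auto simp: window_def)
    have len: "length u = l"
      by (simp add: \<omega>(2))
    have "u \<in> lang"
      unfolding \<omega>(2) by (rule Omega_windowD[OF \<omega>(1)])
    moreover have "length u \<le> N n" "u \<noteq> []"
      using assms len by auto
    ultimately obtain x y a where "x \<in> set (W n)" "y \<in> set (W n)" "a \<in> ?I" "u = window (glue x ?s y) a l"
      using lang_words_glue[of u n] unfolding len by blast
    then show "u \<in> ?f ` (set (W n) \<times> set (W n) \<times> ?I)"
      by (intro image_eqI[of _ _ "(x, y, a)"]) auto
  qed
  then have "complexity Omega l \<le> card (?f ` (set (W n) \<times> set (W n) \<times> ?I))"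
    unfolding complexity_def by (intro card_mono) auto
  also have "\<dots> \<le> card (set (W n) \<times> set (W n) \<times> ?I)"
    by (intro card_image_le) auto
  also have "\<dots> = card (set (W n)) * card (set (W n)) * (l + 2 * length ?s)"
  proof -
    have "nat (int (length ?s) - - int (l + length ?s)) = l + 2 * length ?s"
      by linarith
    then show ?thesis
      by (simp only: card_cartesian_product card_atLeastLessThan_int mult.assoc)
  qed
  also have "\<dots> \<le> (length (W n))\<^sup>2 * (l + 2 * length ?s)"
    unfolding power2_eq_square by (intro mult_le_mono card_length order_refl)
  finally show ?thesis .
qed

end


section \<open>Energies shared by a level of the tower\<close>

definition level_bands :: "('b \<Rightarrow> real) \<Rightarrow> 'b list list \<Rightarrow> real set" where
  "level_bands v W = (\<Union>w\<in>set W. band v w)"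

lemma sets_level_bands [measurable]: "level_bands v W \<in> sets borel"
  unfolding level_bands_def by (intro borel_open open_UN) (auto simp: open_band)

lemma emeasure_level_bands_pos:
  assumes "W \<noteq> []" "\<And>w. w \<in> set W \<Longrightarrow> w \<noteq> []"
  shows "emeasure lborel (level_bands v W) > 0"
proof -
  have "band v (hd W) \<subseteq> level_bands v W"
    using hd_in_set[OF assms(1)] by (auto simp: level_bands_def)
  then have "emeasure lborel (band v (hd W)) \<le> emeasure lborel (level_bands v W)"
    by (intro emeasure_mono) (auto simp: sets_level_bands)
  moreover have "emeasure lborel (band v (hd W)) > 0"
    using assms by (intro emeasure_band_pos) auto
  ultimately show ?thesis
    by (rule less_le_trans[rotated])
qed

text \<open>The losses of the single words add up, so each word is allowed an equal share of \<open>d\<close>.\<close>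

lemma level_bands_loss_small:
  fixes v :: "nat \<Rightarrow> 'b \<Rightarrow> real" and d :: real
  assumes ne: "\<And>w. w \<in> set W \<Longrightarrow> w \<noteq> []" and "d > 0"
  obtains J where "J \<ge> 2"
    and "\<And>N t. t \<le> n \<Longrightarrow> emeasure lborel (level_bands (v t) W - level_bands (v t) (next_level N J W)) \<le> ennreal d"
proof -
  define c where "c = real (card (set W))"
  define d' where "d' = d / (c + 1)"
  have c: "c \<ge> 0"
    by (simp add: c_def)
  have d': "d' > 0"
    using assms(2) c by (simp add: d'_def)
  let ?s = "concat W"
  have "\<exists>J0. \<forall>J\<ge>J0. \<forall>N. emeasure lborel (band (v t) w - (\<Union>j<J. band (v t) (wpow (N + j) w @ ?s))) \<le> ennreal d'"
    if "w \<in> set W" for w t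
    using d' by (intro band_loss_small ne that) simp
  then obtain J0 where J0: "\<And>w t J N. w \<in> set W \<Longrightarrow> J \<ge> J0 w t \<Longrightarrow>
      emeasure lborel (band (v t) w - (\<Union>j<J. band (v t) (wpow (N + j) w @ ?s))) \<le> ennreal d'"
    by metis
  define J where "J = 2 + (\<Sum>w\<in>set W. \<Sum>t\<le>n. J0 w t)"
  have "emeasure lborel (level_bands (v t) W - level_bands (v t) (next_level N J W)) \<le> ennreal d"
    if t: "t \<le> n" for N t
  proof -
    let ?B = "\<lambda>w. band (v t) w - (\<Union>j<J. band (v t) (wpow (N + j) w @ ?s))"
    have Bm: "?B w \<in> sets borel" for w
      by (intro sets.Diff borel_open open_UN) (auto simp: open_band sets_band)
    have "level_bands (v t) W - level_bands (v t) (next_level N J W) \<subseteq> (\<Union>w\<in>set W. ?B w)"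
      by (auto simp: level_bands_def set_next_level)
    then have "emeasure lborel (level_bands (v t) W - level_bands (v t) (next_level N J W))
        \<le> emeasure lborel (\<Union>w\<in>set W. ?B w)"
      using Bm by (intro emeasure_mono) auto
    also have "\<dots> \<le> (\<Sum>w\<in>set W. emeasure lborel (?B w))"
      using Bm by (intro emeasure_subadditive_finite) auto
    also have "\<dots> \<le> (\<Sum>w\<in>set W. ennreal d')"
    proof (intro sum_mono J0)
      fix w
      assume w: "w \<in> set W"
      have "J0 w t \<le> (\<Sum>t\<le>n. J0 w t)"
        using t by (intro member_le_sum) auto
      also have "\<dots> \<le> (\<Sum>w\<in>set W. \<Sum>t\<le>n. J0 w t)"
        using w by (intro member_le_sum) auto
      finally show "J0 w t \<le> J"
        by (simp add: J_def)
    qed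
    also have "\<dots> = ennreal (c * d')"
      using d' by (simp add: c_def ennreal_mult ennreal_of_nat_eq_real_of_nat)
    also have "\<dots> \<le> ennreal d"
      using c assms(2) by (intro ennreal_leI) (simp add: d'_def field_simps)
    finally show ?thesis .
  qed
  then show ?thesis
    by (intro that[of J]) (auto simp: J_def)
qed

lemma length_concat_next_level:
  assumes "J \<le> N" "1 \<le> N"
  shows "length (concat (next_level N J W)) \<le> length W * J * (3 * N * length (concat W))"
proof -
  have "length x \<le> 3 * N * length (concat W)" if "x \<in> set (next_level N J W)" for x
  proof -
    obtain w j where w: "w \<in> set W" "j < J" "x = wpow (N + j) w @ concat W"
      using \<open>x \<in> set (next_level N J W)\<close> by (auto simp: set_next_level)
    have "length w \<le> length (concat W)"
      by (rule sublist_length_le[OF sublist_concatI[OF w(1)]])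
    then have "length x \<le> (N + j) * length (concat W) + 1 * length (concat W)"
      by (simp add: w(3))
    also have "\<dots> = (N + j + 1) * length (concat W)"
      by (simp add: algebra_simps)
    also have "\<dots> \<le> 3 * N * length (concat W)"
      using w(2) assms by (intro mult_le_mono) auto
    finally show ?thesis .
  qed
  then show ?thesis
    using length_concat_le[of "next_level N J W" "3 * N * length (concat W)"]
    by (simp only: length_next_level)
qed

lemma finite_ennreal_lower_bound:
  assumes "finite A" "\<And>a. a \<in> A \<Longrightarrow> a > (0::ennreal)"
  shows "\<exists>x>0. \<forall>a\<in>A. ennreal x \<le> a"
  using assms
proof (induction A)
  case empty
  then show ?case
    by (intro exI[of _ 1]) auto
next
  case (insert a A)
  then obtain x where x: "x > 0" "\<And>b. b \<in> A \<Longrightarrow> ennreal x \<le> b"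
    by auto
  obtain y where y: "y > 0" "ennreal y \<le> a"
  proof (cases a)
    case (real r)
    then show ?thesis
      using insert.prems[of a] by (intro that[of r]) auto
  next
    case top
    then show ?thesis
      by (intro that[of 1]) auto
  qed
  have m: "ennreal (min x y) \<le> ennreal x" "ennreal (min x y) \<le> ennreal y"
    by (intro ennreal_leI; simp)+
  have "ennreal (min x y) \<le> b" if "b \<in> insert a A" for b
    using that order_trans[OF m(1) x(2)] order_trans[OF m(2) y(2)] by blast
  then show ?case
    using x(1) y(1) by (intro exI[of _ "min x y"]) auto
qed

text \<open>The left-hand side is the bound of \<open>complexity_Omega_le\<close>; the constant 20 is what level 0
  requires.\<close>

definition counting_bound :: "real \<Rightarrow> nat list list \<Rightarrow> nat \<Rightarrow> bool" where
  "counting_bound \<epsilon> W q \<longleftrightarrow>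
     (\<forall>l\<ge>q. real ((length W)\<^sup>2 * (l + 2 * length (concat W))) \<le> 20 * real l powr (1 + \<epsilon>))"

text \<open>The number \<open>K\<close> in the proof collects everything that is known before \<open>N\<close> is chosen; the choice
  makes \<open>N powr \<epsilon>\<close> exceed it.\<close>

lemma counting_bound_next_level:
  assumes "\<epsilon> > 0"
  obtains N where "N > q" "counting_bound \<epsilon> (next_level N J W) N"
proof -
  define r where "r = length W * J"
  define S where "S = length (concat W)"
  define K where "K = real (r\<^sup>2 * (1 + 6 * r * S))"
  define N where "N = Suc (q + J + nat \<lceil>K powr (1 / \<epsilon>)\<rceil>)"
  have N: "N > q" "J \<le> N" "1 \<le> N" "K powr (1 / \<epsilon>) \<le> real N"
    unfolding N_def by (auto intro: order_trans[OF real_nat_ceiling_ge])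
  have K0: "K \<ge> 0"
    by (simp add: K_def)
  have "K = (K powr (1 / \<epsilon>)) powr \<epsilon>"
    using assms K0 by (cases "K = 0") (auto simp: powr_powr)
  also have "\<dots> \<le> real N powr \<epsilon>"
    using N assms by (intro powr_mono2) auto
  finally have KN: "K \<le> real N powr \<epsilon>" .
  have "real ((length (next_level N J W))\<^sup>2 * (l + 2 * length (concat (next_level N J W)))) \<le> 20 * real l powr (1 + \<epsilon>)"
    if l: "l \<ge> N" for l
  proof -
    have "length (concat (next_level N J W)) \<le> r * (3 * N * S)"
      using length_concat_next_level[OF N(2,3), of W] by (simp add: r_def S_def)
    also have "\<dots> \<le> r * (3 * l * S)"
      using l by (intro mult_le_mono) auto
    finally have "r\<^sup>2 * (l + 2 * length (concat (next_level N J W))) \<le> r\<^sup>2 * (l + 2 * (r * (3 * l * S)))"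
      by (intro mult_le_mono add_mono) auto
    also have "\<dots> = r\<^sup>2 * (1 + 6 * r * S) * l"
      by (simp add: algebra_simps)
    finally have "real (r\<^sup>2 * (l + 2 * length (concat (next_level N J W)))) \<le> K * real l"
      unfolding K_def by (metis of_nat_le_iff of_nat_mult)
    also have "K * real l \<le> real l powr \<epsilon> * real l"
      using KN l assms by (intro mult_right_mono order_trans[OF KN] powr_mono2) auto
    also have "\<dots> = real l powr (1 + \<epsilon>)"
      using l N by (simp add: powr_add)
    also have "\<dots> \<le> 20 * real l powr (1 + \<epsilon>)"
      by simp
    finally show ?thesis
      by (simp add: length_next_level r_def)
  qed
  then have "counting_bound \<epsilon> (next_level N J W) N"
    unfolding counting_bound_def by blast
  with N(1) show ?thesis
    by (rule that)
qed

text \<open>A state of the recursion consists of the words, the number \<open>N\<close> that was used to form them, and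
  the loss \<open>\<delta>\<close> that is allowed in the next step. The allowed losses at least halve from step to
  step, so from level \<open>t\<close> on they add up to at most \<open>2 \<delta> t\<close>, half of the lower bound \<open>4 \<delta> t\<close> on
  the measure present at level \<open>t\<close>.\<close>

lemma tower_exists:
  fixes v :: "nat \<Rightarrow> nat \<Rightarrow> real"
  assumes \<epsilon>: "\<epsilon> > 0"
  obtains W N J \<delta> where "tower W N J"
    and "counting_bound \<epsilon> (W 0) 1" and "\<And>n. counting_bound \<epsilon> (W (Suc n)) (N n)"
    and "\<And>n. \<delta> n > (0::real)" and "\<And>n. \<delta> (Suc n) \<le> \<delta> n / 2"
    and "\<And>n t. t \<le> n \<Longrightarrow> ennreal (4 * \<delta> n) \<le> emeasure lborel (level_bands (v t) (W n))"
    and "\<And>n t. t \<le> n \<Longrightarrow> emeasure lborel (level_bands (v t) (W n) - level_bands (v t) (W (Suc n))) \<le> ennreal (\<delta> n)"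
proof -
  define good :: "nat \<Rightarrow> nat list list \<times> nat \<times> real \<Rightarrow> bool" where
    "good = (\<lambda>n (W, q, d). W \<noteq> [] \<and> (\<forall>w\<in>set W. w \<noteq> []) \<and> counting_bound \<epsilon> W q \<and> d > 0 \<and> q > n \<and>
       (\<forall>t\<le>n. ennreal (4 * d) \<le> emeasure lborel (level_bands (v t) W)) \<and>
       (n = 0 \<longrightarrow> W = [[1], [2]] \<and> q = 1))"
  define next_ok :: "nat \<Rightarrow> nat list list \<times> nat \<times> real \<Rightarrow> nat list list \<times> nat \<times> real \<Rightarrow> bool" where
    "next_ok = (\<lambda>n (W, q, d) (W', q', d'). (\<exists>J\<ge>2. W' = next_level q' J W) \<and> d' \<le> d / 2 \<and>
       (\<forall>t\<le>n. emeasure lborel (level_bands (v t) W - level_bands (v t) W') \<le> ennreal d))"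
  have pick: "\<exists>d>0. d \<le> b \<and> (\<forall>t\<le>n. ennreal (4 * d) \<le> emeasure lborel (level_bands (v t) W))"
    if "b > 0" "W \<noteq> []" "\<And>w. w \<in> set W \<Longrightarrow> w \<noteq> []" for W n and b :: real
  proof -
    have "\<exists>x>0. \<forall>a\<in>(\<lambda>t. emeasure lborel (level_bands (v t) W)) ` {..n}. ennreal x \<le> a"
      using emeasure_level_bands_pos[OF that(2,3)] by (intro finite_ennreal_lower_bound) auto
    then obtain x where x: "x > 0" "\<And>t. t \<le> n \<Longrightarrow> ennreal x \<le> emeasure lborel (level_bands (v t) W)"
      by auto
    have "ennreal (4 * min b (x / 4)) \<le> emeasure lborel (level_bands (v t) W)" if "t \<le> n" for t
      using x(2)[OF that] by (rule order_trans[rotated]) (auto intro!: ennreal_leI)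
    then show ?thesis
      using that(1) x(1) by (intro exI[of _ "min b (x / 4)"]) auto
  qed
  have "\<exists>x. good 0 x"
  proof -
    have "counting_bound \<epsilon> [[1], [2]] 1"
      unfolding counting_bound_def
    proof (intro allI impI)
      fix l :: nat
      assume l: "1 \<le> l"
      have "real ((length [[1], [2::nat]])\<^sup>2 * (l + 2 * length (concat [[1], [2::nat]]))) \<le> 20 * real l powr 1"
        using l by simp
      also have "\<dots> \<le> 20 * real l powr (1 + \<epsilon>)"
        using l \<epsilon> by (intro mult_left_mono powr_mono) auto
      finally show "real ((length [[1], [2::nat]])\<^sup>2 * (l + 2 * length (concat [[1], [2::nat]]))) \<le> 20 * real l powr (1 + \<epsilon>)" .
    qed
    moreover obtain d where "d > 0" "\<forall>t\<le>0. ennreal (4 * d) \<le> emeasure lborel (level_bands (v t) [[1], [2]])"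
      using pick[where b = 1 and W = "[[1], [2]]" and n = 0] by auto
    ultimately show ?thesis
      by (intro exI[of _ "([[1], [2]], 1, d)"]) (simp add: good_def)
  qed
  moreover have "\<exists>y. good (Suc n) y \<and> next_ok n x y" if "good n x" for n x
  proof -
    obtain W q d where x: "x = (W, q, d)"
      by (cases x) auto
    have W: "W \<noteq> []" "\<And>w. w \<in> set W \<Longrightarrow> w \<noteq> []" "d > 0" "q > n"
      using that by (auto simp: good_def x)
    obtain J where J: "J \<ge> 2" "\<And>N t. t \<le> n \<Longrightarrow>
        emeasure lborel (level_bands (v t) W - level_bands (v t) (next_level N J W)) \<le> ennreal d"
      using level_bands_loss_small[where n = n and v = v, OF W(2) W(3)] by blast
    obtain N where N: "N > q" "counting_bound \<epsilon> (next_level N J W) N"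
      using counting_bound_next_level[OF \<epsilon>, where q = q and J = J and W = W] by blast
    have "length (next_level N J W) > 0"
      using J(1) W(1) by (simp add: length_next_level)
    then have ne1: "next_level N J W \<noteq> []"
      by simp
    have "concat W \<noteq> []"
      using W(1,2) by (cases W) auto
    then have ne2: "w \<noteq> []" if "w \<in> set (next_level N J W)" for w
      using that by (auto simp: set_next_level)
    obtain d' where d': "d' > 0" "d' \<le> d / 2"
      "\<forall>t\<le>Suc n. ennreal (4 * d') \<le> emeasure lborel (level_bands (v t) (next_level N J W))"
      using pick[where b = "d / 2" and n = "Suc n", OF _ ne1 ne2] W(3) by auto
    have "good (Suc n) (next_level N J W, N, d')"
      using ne1 ne2 N d' W(4) by (simp add: good_def)
    moreover have "next_ok n x (next_level N J W, N, d')"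
      unfolding next_ok_def x using J d' by auto
    ultimately show ?thesis
      by blast
  qed
  ultimately obtain f where f: "\<And>n. good n (f n)" "\<And>n. next_ok n (f n) (f (Suc n))"
    using dependent_nat_choice[of good next_ok] by blast
  define W where "W = (\<lambda>n. fst (f n))"
  define q where "q = (\<lambda>n. fst (snd (f n)))"
  define \<delta> where "\<delta> = (\<lambda>n. snd (snd (f n)))"
  have fn: "f n = (W n, q n, \<delta> n)" for n
    by (simp add: W_def q_def \<delta>_def)
  have g: "counting_bound \<epsilon> (W n) (q n)" "\<delta> n > 0" "q n > n"
    "t \<le> n \<Longrightarrow> ennreal (4 * \<delta> n) \<le> emeasure lborel (level_bands (v t) (W n))"
    "W 0 = [[1], [2]]" "q 0 = 1" for n t
    using f(1)[of n] f(1)[of 0] unfolding fn good_def by auto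
  have h: "\<exists>J\<ge>2. W (Suc n) = next_level (q (Suc n)) J (W n)" "\<delta> (Suc n) \<le> \<delta> n / 2"
    "t \<le> n \<Longrightarrow> emeasure lborel (level_bands (v t) (W n) - level_bands (v t) (W (Suc n))) \<le> ennreal (\<delta> n)" for n t
    using f(2)[of n] unfolding fn next_ok_def by auto
  obtain J where J: "\<And>n. J n \<ge> 2" "\<And>n. W (Suc n) = next_level (q (Suc n)) (J n) (W n)"
    using h(1) by metis
  have "tower W (\<lambda>n. q (Suc n)) J"
    by unfold_locales (use g(3,5) J in \<open>auto intro: Suc_lessD\<close>)
  then show ?thesis
  proof (rule that[where \<delta> = \<delta>])
    show "counting_bound \<epsilon> (W 0) 1"
      using g(1)[of 0] g(6) by simp
  qed (use g(1,2,4) h(2,3) in blast)+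
qed


section \<open>The spectrum over a tower\<close>

context tower
begin

lemma potential_bound_Omega: "\<omega> \<in> Omega \<Longrightarrow> potential_bound v \<omega> (\<bar>v 1\<bar> + \<bar>v 2\<bar>)"
  unfolding potential_bound_def using Omega_letters[of \<omega>] by (auto simp: insert_iff) (metis abs_ge_zero add_increasing add_increasing2 order_refl)

lemma spectrum_Omega:
  assumes "\<omega> \<in> Omega"
  shows "has_spectrum_over Omega v (ell2_spectrum (schroedinger v \<omega>))"
proof -
  have "z \<notin> ell2_spectrum (schroedinger v \<omega>')"
    if "\<omega> \<in> Omega" "\<omega>' \<in> Omega" "z \<notin> ell2_spectrum (schroedinger v \<omega>)" for \<omega> \<omega>' z
    using that Omega_locally_equal[OF that(1,2)] bounded_below_local[of \<omega>' \<omega> v z]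
      not_in_ell2_spectrum_iff[OF potential_bound_Omega] by metis
  then show ?thesis
    using assms unfolding has_spectrum_over_def by blast
qed

lemma level_bands_subset_spectrum:
  assumes "\<omega> \<in> Omega"
  shows "(\<Inter>n\<in>{t..}. level_bands v (W n)) \<subseteq> complex_of_real -` ell2_spectrum (schroedinger v \<omega>)"
proof
  fix E
  assume E: "E \<in> (\<Inter>n\<in>{t..}. level_bands v (W n))"
  have "of_real E \<in> ell2_spectrum (schroedinger v \<omega>)"
  proof (rule ccontr)
    assume "of_real E \<notin> ell2_spectrum (schroedinger v \<omega>)"
    then obtain c where c: "c > 0" and below: "bounded_below v \<omega> (of_real E) c"
      using not_in_ell2_spectrum_iff[OF potential_bound_Omega[OF assms]] by blast
    define n where "n = t + nat \<lceil>16 / c\<^sup>2\<rceil>"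
    obtain w where w: "w \<in> set (W n)" "E \<in> band v w"
    proof -
      have "E \<in> level_bands v (W n)"
        using E by (rule INT_D) (simp add: n_def)
      then show ?thesis
        using that by (auto simp: level_bands_def)
    qed
    obtain a where a: "\<And>i. i < N n * length w \<Longrightarrow> \<omega> (a + int i) = w ! (i mod length w)"
      using power_occurs[OF w(1) assms] by blast
    have "c\<^sup>2 * real (N n) \<le> 16"
      using W_words[OF w(1)] c by (intro approximate_eigenvector_in_power[OF w(2) _ a below]) auto
    then have "real (N n) \<le> 16 / c\<^sup>2"
      using c by (simp add: field_simps)
    also have "\<dots> \<le> real n"
      unfolding n_def by (simp add: add_increasing real_nat_ceiling_ge)
    finally show False
      using N_gt[of n] by simp
  qed
  then show "E \<in> complex_of_real -` ell2_spectrum (schroedinger v \<omega>)"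
    by simp
qed

text \<open>An energy that is good at level \<open>t\<close> is either lost in one of the later steps or good forever, and
  the losses add up to at most \<open>2 \<delta> t\<close>.\<close>

lemma spectrum_Omega_positive_measure:
  assumes \<omega>: "\<omega> \<in> Omega" and \<delta>: "\<And>n. \<delta> n > (0::real)" "\<And>n. \<delta> (Suc n) \<le> \<delta> n / 2"
    and start: "ennreal (4 * \<delta> t) \<le> emeasure lborel (level_bands v (W t))"
    and loss: "\<And>n. n \<ge> t \<Longrightarrow> emeasure lborel (level_bands v (W n) - level_bands v (W (Suc n))) \<le> ennreal (\<delta> n)"
  shows "real_lebesgue_measure (ell2_spectrum (schroedinger v \<omega>)) > 0"
proof -
  let ?S = "complex_of_real -` ell2_spectrum (schroedinger v \<omega>)"
  define A where "A n = level_bands v (W (t + n))" for n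
  define D where "D = (\<Inter>n\<in>{t..}. level_bands v (W n))"
  have Dn: "D = (\<Inter>n. A n)"
    unfolding D_def A_def by (auto simp: le_iff_add)
  have Am: "A n \<in> sets borel" for n
    by (simp add: A_def sets_level_bands)
  have Dm: "D \<in> sets borel"
    unfolding Dn using Am by (intro sets.countable_INT) auto
  have cover: "A 0 \<subseteq> D \<union> (\<Union>n. A n - A (Suc n))"
  proof
    fix E
    assume E: "E \<in> A 0"
    show "E \<in> D \<union> (\<Union>n. A n - A (Suc n))"
    proof (rule ccontr)
      assume *: "E \<notin> D \<union> (\<Union>n. A n - A (Suc n))"
      have "E \<in> A n" for n
        by (induction n) (use E * in auto)
      then show False
        using * by (auto simp: Dn)
    qed
  qed
  have geo: "\<delta> (t + n) \<le> \<delta> t * (1 / 2) ^ n" for n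
  proof (induction n)
    case (Suc n)
    then show ?case
      using \<delta>(2)[of "t + n"] by simp
  qed simp
  have sums: "(\<lambda>n. \<delta> t * (1 / 2) ^ n) sums (2 * \<delta> t)"
    using sums_mult[OF geometric_sums[of "1 / 2 :: real"], of "\<delta> t"] by (simp add: mult.commute)
  have "emeasure lborel (\<Union>n. A n - A (Suc n)) \<le> (\<Sum>n. emeasure lborel (A n - A (Suc n)))"
    using Am by (intro emeasure_subadditive_countably) auto
  also have "\<dots> \<le> (\<Sum>n. ennreal (\<delta> t * (1 / 2) ^ n))"
  proof (intro suminf_le)
    show "emeasure lborel (A n - A (Suc n)) \<le> ennreal (\<delta> t * (1 / 2) ^ n)" for n
      using loss[of "t + n"] ennreal_leI[OF geo[of n]] by (auto simp: A_def intro: order_trans)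
  qed auto
  also have "\<dots> = ennreal (2 * \<delta> t)"
    using \<delta>(1)[of t] sums_unique[OF sums] sums_summable[OF sums] by (subst suminf_ennreal2) auto
  finally have U: "emeasure lborel (\<Union>n. A n - A (Suc n)) \<le> ennreal (2 * \<delta> t)" .
  have "ennreal (4 * \<delta> t) \<le> emeasure lborel (A 0)"
    using start by (simp add: A_def)
  also have "\<dots> \<le> emeasure lborel (D \<union> (\<Union>n. A n - A (Suc n)))"
    using cover Dm Am by (intro emeasure_mono) auto
  also have "\<dots> \<le> emeasure lborel D + emeasure lborel (\<Union>n. A n - A (Suc n))"
    using Dm Am by (intro emeasure_subadditive) auto
  also have "\<dots> \<le> emeasure lborel D + ennreal (2 * \<delta> t)"
    using U by (rule add_left_mono)
  finally have le: "ennreal (4 * \<delta> t) \<le> emeasure lborel D + ennreal (2 * \<delta> t)" .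
  have "emeasure lborel D \<noteq> 0"
  proof
    assume "emeasure lborel D = 0"
    then have "4 * \<delta> t \<le> 2 * \<delta> t"
      using le \<delta>(1)[of t] by simp
    then show False
      using \<delta>(1)[of t] by simp
  qed
  then have "0 < emeasure lborel D"
    by (simp add: zero_less_iff_neq_zero)
  also have clo: "?S \<in> sets borel"
    by (rule borel_closed[OF closed_ell2_spectrum[OF potential_bound_Omega[OF \<omega>]]])
  then have "emeasure lborel D \<le> emeasure lborel ?S"
    using level_bands_subset_spectrum[OF \<omega>, where t = t and v = v] by (intro emeasure_mono) (auto simp: D_def)
  also have "emeasure lborel ?S = real_lebesgue_measure (ell2_spectrum (schroedinger v \<omega>))"
    using clo by (simp add: real_lebesgue_measure_def)
  finally show ?thesis .
qed

text \<open>Each length is counted at the first level whose exponent \<open>N n\<close> reaches it; the previous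
  exponent is then smaller than the length.\<close>

lemma complexity_Omega_powr:
  assumes \<epsilon>: "\<epsilon> > 0" and "counting_bound \<epsilon> (W 0) 1" "\<And>n. counting_bound \<epsilon> (W (Suc n)) (N n)"
    and l: "l \<ge> 1"
  shows "real (complexity Omega l) \<le> 20 * real l powr (1 + \<epsilon>)"
proof -
  define n where "n = (LEAST n. l \<le> N n)"
  have "l \<le> N l"
    using N_gt[of l] by simp
  then have n: "l \<le> N n"
    unfolding n_def by (rule LeastI)
  have "\<exists>q\<le>l. counting_bound \<epsilon> (W n) q"
  proof (cases n)
    case 0
    then show ?thesis
      using assms(2) l by auto
  next
    case (Suc m)
    then have "\<not> l \<le> N m"
      using not_less_Least[of m "\<lambda>n. l \<le> N n"] by (simp add: n_def)
    then show ?thesis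
      using assms(3)[of m] Suc by (intro exI[of _ "N m"]) auto
  qed
  then have "real ((length (W n))\<^sup>2 * (l + 2 * length (concat (W n)))) \<le> 20 * real l powr (1 + \<epsilon>)"
    unfolding counting_bound_def by blast
  moreover have "real (complexity Omega l) \<le> real ((length (W n))\<^sup>2 * (l + 2 * length (concat (W n))))"
    using complexity_Omega_le[OF l n] by (simp only: of_nat_le_iff)
  ultimately show ?thesis
    by linarith
qed

end


section \<open>Low complexity and positive measure\<close>

theorem theorem4:
  fixes k :: nat and \<epsilon> :: real and B :: "(nat \<Rightarrow> real) set"
  assumes "k \<ge> 2" and "\<epsilon> > 0"
    and "B \<subseteq> {1..k} \<rightarrow>\<^sub>E UNIV" and "countable B"
    and "\<forall>v\<in>B. \<not> v constant_on {1..k}"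
  shows "\<exists>C>0. \<exists>\<Omega>. minimal_subshift k \<Omega> \<and> aperiodic \<Omega> \<and>
           (\<forall>n\<ge>1. real (complexity \<Omega> n) < C * real n powr (1 + \<epsilon>)) \<and>
           (\<forall>v\<in>B. \<exists>S. has_spectrum_over \<Omega> v S \<and> real_lebesgue_measure S > 0)"
proof -
  obtain W N J \<delta> where tw: "tower W N J"
    and cb: "counting_bound \<epsilon> (W 0) 1" "\<And>n. counting_bound \<epsilon> (W (Suc n)) (N n)"
    and \<delta>: "\<And>n. \<delta> n > (0::real)" "\<And>n. \<delta> (Suc n) \<le> \<delta> n / 2"
    and start: "\<And>n t. t \<le> n \<Longrightarrow> ennreal (4 * \<delta> n) \<le> emeasure lborel (level_bands (from_nat_into B t) (W n))"
    and loss: "\<And>n t. t \<le> n \<Longrightarrow> emeasure lborel (level_bands (from_nat_into B t) (W n)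
        - level_bands (from_nat_into B t) (W (Suc n))) \<le> ennreal (\<delta> n)"
    using tower_exists[OF \<open>\<epsilon> > 0\<close>, of "from_nat_into B"] by blast
  interpret tower W N J
    by (rule tw)
  obtain \<omega> where \<omega>: "\<omega> \<in> Omega"
    using compactin_Omega_and_nonempty(2)[OF \<open>k \<ge> 2\<close>] by blast
  have "real (complexity Omega n) < 21 * real n powr (1 + \<epsilon>)" if "n \<ge> 1" for n
  proof -
    have "real (complexity Omega n) \<le> 20 * real n powr (1 + \<epsilon>)"
      by (rule complexity_Omega_powr[OF \<open>\<epsilon> > 0\<close> cb that])
    moreover have "real n powr (1 + \<epsilon>) > 0"
      using that by simp
    ultimately show ?thesis
      by linarith
  qed
  moreover have "\<exists>S. has_spectrum_over Omega v S \<and> real_lebesgue_measure S > 0" if v: "v \<in> B" for v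
  proof -
    obtain t where t: "v = from_nat_into B t"
      using subset_range_from_nat_into[OF \<open>countable B\<close>] v by auto
    have "real_lebesgue_measure (ell2_spectrum (schroedinger v \<omega>)) > 0"
      unfolding t by (rule spectrum_Omega_positive_measure[OF \<omega> \<delta> start loss]) auto
    then show ?thesis
      using spectrum_Omega[OF \<omega>] by blast
  qed
  ultimately show ?thesis
    using minimal_Omega[OF \<open>k \<ge> 2\<close>] aperiodic_Omega
    by (intro exI[of _ 21] conjI exI[of _ Omega]) auto
qed

end
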